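(* Let $\varepsilon>0$. Let $\pi=e^{-V}$ be a log-concave probability density on $\mathbb{R}^d$, with $V:\mathbb{R}^d\to\mathbb{R}$ convex and twice continuously differentiable. Let $\pi_\beta$ be the probability measure with density proportional to $e^{-V-\beta\|\cdot\|^2}$, where $0<\beta\le \varepsilon^2/\bigl(2\int\|x\|^2\,d\pi(x)\bigr)$. Then the law $(\mu_t)_{t\ge0}$ of the Newton-Langevin diffusion with target distribution $\pi_\beta$ satisfies $\|\mu_t-\pi\|_{\rm TV}\le\varepsilon$ by time $$t=\tfrac12\ln\bigl[2\chi^2(\mu_0\,\|\,\pi_\beta)\bigr]+\ln(1/\varepsilon),$$ i.e. for all $t\ge 0$ at least as large as this value.
   Context: For a probability density $e^{-U}$ on $\mathbb{R}^d$ with $U$ strictly convex and twice continuously differentiable, the Newton-Langevin diffusion $(X_t)_{t\ge0}$ with target $e^{-U}$ is the solution of $$X_t=\nabla U^\star(Y_t),\qquad dY_t=-\nabla U(X_t)\,dt+\sqrt2\,[\nabla^2U(X_t)]^{1/2}\,dB_t,$$ where $U^\star$ is the convex conjugate of $U$ and $(B_t)$ is a standard Brownian motion in $\mathbb{R}^d$; $\mu_t$ is the law of $X_t$. Here $U=V+\beta\|\cdot\|^2+\text{const}$. Standing assumption: $\mu_t$ (identified with its Lebesgue density) is the unique solution of the Fokker–Planck equation $\partial_t\mu_t=\operatorname{div}\bigl(\mu_t(\nabla^2U)^{-1}\nabla\ln\frac{\mu_t}{\pi_\beta}\bigr)$, with enough regularity that (when $\chi^2(\mu_0\|\pi_\beta)<\infty$)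 $\int\mu_t^2/\pi_\beta$ may be differentiated in $t$ under the integral sign and the resulting integral integrated by parts without boundary terms. Notation: $\chi^2(\mu\|\pi)=\int(\frac{d\mu}{d\pi})^2d\pi-1$ if $\mu\ll\pi$ and $+\infty$ otherwise; $\|\mu-\pi\|_{\rm TV}=\sup_A|\mu(A)-\pi(A)|$. *)

theory Defs
  imports "HOL-Probability.Probability"
begin

section \<open>Differential operators\<close>

definition grad :: "('a::real_inner \<Rightarrow> real) \<Rightarrow> 'a \<Rightarrow> 'a"
  where "grad f x = (THE D. GDERIV f x :> D)"

definition hessian :: "(real^'n \<Rightarrow> real) \<Rightarrow> real^'n \<Rightarrow> real^'n^'n"
  where "hessian f x = jacobian (grad f) (at x)"

definition divergence :: "(real^'n \<Rightarrow> real^'n) \<Rightarrow> real^'n \<Rightarrow> real"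
  where "divergence F x = trace (jacobian F (at x))"

definition twice_continuously_differentiable :: "(real^'n \<Rightarrow> real) \<Rightarrow> bool"
  where "twice_continuously_differentiable f \<longleftrightarrow>
    (\<forall>x. f differentiable (at x)) \<and> (\<forall>x. grad f differentiable (at x)) \<and>
    continuous_on UNIV (hessian f)"

text \<open>The principal (symmetric positive semidefinite) square root.\<close>

definition matrix_sqrt :: "real^'n^'n \<Rightarrow> real^'n^'n"
  where "matrix_sqrt A =
    (THE S. transpose S = S \<and> (\<forall>v. 0 \<le> v \<bullet> (S *v v)) \<and> S ** S = A)"

text \<open>The supremum is taken in the reals, so this is meaningful only where it is finite.
  For strongly convex \<open>U\<close>, such as the tilted potentials below, that is everywhere.\<close>

definition convex_conjugate :: "('a::real_inner \<Rightarrow> real) \<Rightarrow> 'a \<Rightarrow> real"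
  where "convex_conjugate U y = (SUP x. x \<bullet> y - U x)"


section \<open>Target measures and divergences\<close>

definition gibbs :: "('a::euclidean_space \<Rightarrow> real) \<Rightarrow> 'a measure"
  where "gibbs U = density lborel (\<lambda>x. ennreal (exp (- U x)))"

text \<open>The additive constant is the logarithm of the partition function, so that
  \<open>gibbs (tilted V \<beta>)\<close> is the probability measure with density proportional to
  \<open>exp (- V x - \<beta> * (norm x)\<^sup>2)\<close>.\<close>

definition tilted :: "('a::euclidean_space \<Rightarrow> real) \<Rightarrow> real \<Rightarrow> 'a \<Rightarrow> real"
  where "tilted V \<beta> x = V x + \<beta> * (norm x)\<^sup>2
    + ln (\<integral>y. exp (- V y - \<beta> * (norm y)\<^sup>2) \<partial>lborel)"

definition chi_square_div :: "'a measure \<Rightarrow> 'a measure \<Rightarrow> ennreal"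
  where "chi_square_div \<mu> \<pi> =
    (if absolutely_continuous \<pi> \<mu> then (\<integral>\<^sup>+x. (RN_deriv \<pi> \<mu> x)\<^sup>2 \<partial>\<pi>) - 1 else \<infinity>)"

definition tv_dist :: "'a measure \<Rightarrow> 'a measure \<Rightarrow> real"
  where "tv_dist \<mu> \<nu> = (SUP A\<in>sets \<mu>. \<bar>measure \<mu> A - measure \<nu> A\<bar>)"

definition ln_ennreal :: "ennreal \<Rightarrow> ereal"
  where "ln_ennreal x =
    (if x = 0 then - \<infinity> else if x = \<infinity> then \<infinity> else ereal (ln (enn2real x)))"


section \<open>Brownian motion and the stochastic integral\<close>

text \<open>Processes are indexed by all reals, but only times \<open>t \<ge> 0\<close> carry meaning; a filtration given
  for \<open>t \<ge> 0\<close> extends constantly to negative times.\<close>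

definition brownian_motion ::
    "'w measure \<Rightarrow> (real \<Rightarrow> 'w measure) \<Rightarrow> (real \<Rightarrow> 'w \<Rightarrow> real^'n) \<Rightarrow> bool"
  where "brownian_motion M F B \<longleftrightarrow>
    (\<forall>t\<ge>0. B t \<in> borel_measurable (F t)) \<and>
    (AE \<omega> in M. B 0 \<omega> = 0) \<and>
    (AE \<omega> in M. continuous_on {0..} (\<lambda>t. B t \<omega>)) \<and>
    (\<forall>s t. 0 \<le> s \<and> s < t \<longrightarrow>
      prob_space.indep_set M (sets (F s))
        (sets (vimage_algebra (space M) (\<lambda>\<omega>. B t \<omega> - B s \<omega>) borel)) \<and>
      distributed M lborel (\<lambda>\<omega>. B t \<omega> - B s \<omega>)
        (\<lambda>x. ennreal (\<Prod>i\<in>UNIV. normal_density 0 (sqrt (t - s)) (x $ i))))"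

definition vanishes_in_prob :: "'w measure \<Rightarrow> (nat \<Rightarrow> 'w \<Rightarrow> ennreal) \<Rightarrow> bool"
  where "vanishes_in_prob M Z \<longleftrightarrow>
    (\<forall>e>0. (\<lambda>k. measure M {\<omega> \<in> space M. ennreal e < Z k \<omega>}) \<longlonglongrightarrow> 0)"

text \<open>A simple integrand on \<open>{0..t}\<close> takes the value \<open>\<xi> i\<close> on \<open>{s i<..s (Suc i)}\<close>, \<open>i < n\<close>.\<close>

definition simple_integrand ::
    "'w measure \<Rightarrow> (real \<Rightarrow> 'w measure) \<Rightarrow> real \<Rightarrow> nat \<Rightarrow> (nat \<Rightarrow> real) \<Rightarrow>
      (nat \<Rightarrow> 'w \<Rightarrow> real^'n^'n) \<Rightarrow> bool"
  where "simple_integrand M F t n s \<xi> \<longleftrightarrow>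
    s 0 = 0 \<and> s n = t \<and>
    (\<forall>i<n. s i \<le> s (Suc i) \<and> \<xi> i \<in> borel_measurable (F (s i)) \<and> bounded (\<xi> i ` space M))"

definition simple_process ::
    "nat \<Rightarrow> (nat \<Rightarrow> real) \<Rightarrow> (nat \<Rightarrow> 'w \<Rightarrow> real^'n^'n) \<Rightarrow> real \<Rightarrow> 'w \<Rightarrow> real^'n^'n"
  where "simple_process n s \<xi> r \<omega> = (\<Sum>i<n. indicator {s i<..s (Suc i)} r *\<^sub>R \<xi> i \<omega>)"

definition simple_integral ::
    "(real \<Rightarrow> 'w \<Rightarrow> real^'n) \<Rightarrow> nat \<Rightarrow> (nat \<Rightarrow> real) \<Rightarrow>
      (nat \<Rightarrow> 'w \<Rightarrow> real^'n^'n) \<Rightarrow> 'w \<Rightarrow> real^'n"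
  where "simple_integral B n s \<xi> \<omega> = (\<Sum>i<n. \<xi> i \<omega> *v (B (s (Suc i)) \<omega> - B (s i) \<omega>))"

text \<open>\<open>I\<close> is a version of the Ito integral of \<open>H\<close> against \<open>B\<close> over \<open>{0..t}\<close>.\<close>

definition is_ito_integral ::
    "'w measure \<Rightarrow> (real \<Rightarrow> 'w measure) \<Rightarrow> (real \<Rightarrow> 'w \<Rightarrow> real^'n) \<Rightarrow> real \<Rightarrow>
      (real \<Rightarrow> 'w \<Rightarrow> real^'n^'n) \<Rightarrow> ('w \<Rightarrow> real^'n) \<Rightarrow> bool"
  where "is_ito_integral M F B t H I \<longleftrightarrow>
    I \<in> borel_measurable M \<and>
    (\<exists>n s \<xi>. (\<forall>k. simple_integrand M F t (n k) (s k) (\<xi> k)) \<and>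
      vanishes_in_prob M (\<lambda>k \<omega>. \<integral>\<^sup>+r\<in>{0..t}.
        ennreal ((norm (simple_process (n k) (s k) (\<xi> k) r \<omega> - H r \<omega>))\<^sup>2) \<partial>lborel) \<and>
      vanishes_in_prob M (\<lambda>k \<omega>.
        ennreal (norm (simple_integral B (n k) (s k) (\<xi> k) \<omega> - I \<omega>))))"


section \<open>The Newton-Langevin diffusion and its Fokker-Planck equation\<close>

definition newton_langevin ::
    "(real^'n \<Rightarrow> real) \<Rightarrow> 'w measure \<Rightarrow> (real \<Rightarrow> 'w measure) \<Rightarrow>
      (real \<Rightarrow> 'w \<Rightarrow> real^'n) \<Rightarrow> (real \<Rightarrow> 'w \<Rightarrow> real^'n) \<Rightarrow> (real \<Rightarrow> 'w \<Rightarrow> real^'n) \<Rightarrow> bool"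
  where "newton_langevin U M F B X Y \<longleftrightarrow>
    prob_space M \<and> filtration (space M) F \<and> (\<forall>t. subalgebra M (F t)) \<and>
    brownian_motion M F B \<and>
    (\<forall>t\<ge>0. X t \<in> borel_measurable (F t) \<and> Y t \<in> borel_measurable (F t)) \<and>
    (\<forall>\<omega>\<in>space M. continuous_on {0..} (\<lambda>t. X t \<omega>) \<and> continuous_on {0..} (\<lambda>t. Y t \<omega>)) \<and>
    (\<forall>t\<ge>0. \<forall>\<omega>\<in>space M. X t \<omega> = grad (convex_conjugate U) (Y t \<omega>)) \<and>
    (\<forall>t\<ge>0. \<exists>I. is_ito_integral M F B t (\<lambda>s \<omega>. matrix_sqrt (hessian U (X s \<omega>))) I \<and>
      (AE \<omega> in M. Y t \<omega> =
        Y 0 \<omega> - integral {0..t} (\<lambda>s. grad U (X s \<omega>)) + sqrt 2 *\<^sub>R I \<omega>))"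

definition fp_flux :: "(real^'n \<Rightarrow> real) \<Rightarrow> (real^'n \<Rightarrow> real) \<Rightarrow> real^'n \<Rightarrow> real^'n"
  where "fp_flux U q x =
    q x *\<^sub>R (matrix_inv (hessian U x) *v grad (\<lambda>y. ln (q y / exp (- U y))) x)"

text \<open>Classical solutions at positive times; positivity makes the logarithm meaningful.\<close>

definition fokker_planck :: "(real^'n \<Rightarrow> real) \<Rightarrow> (real \<Rightarrow> real^'n \<Rightarrow> real) \<Rightarrow> bool"
  where "fokker_planck U \<rho> \<longleftrightarrow>
    (\<forall>t>0. \<forall>x. 0 < \<rho> t x \<and> \<rho> t differentiable (at x) \<and>
      fp_flux U (\<rho> t) differentiable (at x) \<and>
      ((\<lambda>s. \<rho> s x) has_real_derivative divergence (fp_flux U (\<rho> t)) x) (at t))"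

text \<open>The functional \<open>\<integral> \<rho>\<^sub>t\<^sup>2 / \<pi>\<close>, \<open>\<pi> = exp (- U)\<close>, can be differentiated in time under the
  integral sign, and the resulting integral, whose integrand is
  \<open>2 (\<rho>\<^sub>t / \<pi>) \<partial>\<^sub>t\<rho>\<^sub>t = 2 (\<rho>\<^sub>t / \<pi>) div (flux)\<close>, can be integrated by parts without
  boundary terms.\<close>

definition fp_regular :: "(real^'n \<Rightarrow> real) \<Rightarrow> (real \<Rightarrow> real^'n \<Rightarrow> real) \<Rightarrow> bool"
  where "fp_regular U \<rho> \<longleftrightarrow>
    (\<forall>t\<ge>0. integrable lborel (\<lambda>x. (\<rho> t x)\<^sup>2 / exp (- U x))) \<and>
    continuous_on {0..} (\<lambda>t. \<integral>x. (\<rho> t x)\<^sup>2 / exp (- U x) \<partial>lborel) \<and>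
    (\<forall>t>0.
      integrable lborel (\<lambda>x. deriv (\<lambda>s. (\<rho> s x)\<^sup>2 / exp (- U x)) t) \<and>
      ((\<lambda>s. \<integral>x. (\<rho> s x)\<^sup>2 / exp (- U x) \<partial>lborel) has_real_derivative
        (\<integral>x. deriv (\<lambda>s. (\<rho> s x)\<^sup>2 / exp (- U x)) t \<partial>lborel)) (at t)) \<and>
    (\<forall>t>0.
      integrable lborel (\<lambda>x. grad (\<lambda>y. 2 * (\<rho> t y / exp (- U y))) x \<bullet> fp_flux U (\<rho> t) x) \<and>
      (\<integral>x. 2 * (\<rho> t x / exp (- U x)) * divergence (fp_flux U (\<rho> t)) x \<partial>lborel) =
        - (\<integral>x. grad (\<lambda>y. 2 * (\<rho> t y / exp (- U y))) x \<bullet> fp_flux U (\<rho> t) x \<partial>lborel))"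

end

theory Submission
  imports Defs
begin

text \<open>Along the Fokker-Planck equation with target \<open>exp (- U)\<close>, the chi-square divergence
  \<open>\<chi>\<close> of \<open>f = \<rho> / exp (- U)\<close> has derivative \<open>- 2 E \<langle>\<nabla>f, (\<nabla>\<^sup>2U)\<^sup>-\<^sup>1 \<nabla>f\<rangle>\<close>, and the Brascamp-Lieb
  inequality bounds this by \<open>- 2 \<chi>\<close>, so that \<open>\<chi>\<close> decays like \<open>exp (- 2 t)\<close>.  The bias
  caused by the quadratic tilt is at most \<open>\<beta> E (norm x)\<^sup>2\<close> in total variation.
  The Brascamp-Lieb inequality is obtained as the second-order term (Bobkov-Ledoux) of the
  midpoint Prekopa-Leindler inequality for \<open>exp (e \<phi> - U)\<close>, \<open>exp (- e \<phi> - U)\<close> and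
  \<open>exp (e\<^sup>2 (\<langle>\<nabla>\<phi>, (\<nabla>\<^sup>2U)\<^sup>-\<^sup>1 \<nabla>\<phi>\<rangle> + \<delta>) / 2 - U)\<close> with \<open>\<phi>\<close> of compact support as \<open>e\<close> tends to 0.\<close>

section \<open>The Prekopa-Leindler inequality at midpoints\<close>

text \<open>The inverse Hessian enters as a Legendre dual. For x = z + e w and y = z - e w, the gain
  e (\<open>\<phi>\<close> x - \<open>\<phi>\<close> y) is about 2 e^2 (w . grad
  \<open>\<phi>\<close> z) and the cost \<open>U\<close> x + \<open>U\<close> y - 2 \<open>U\<close>
  z is about e^2 (w . Hw), H being the Hessian at z; the supremum over w of gain minus cost is e^2
  times the dual form of the gradient. The slack \<open>\<delta>\<close> pays for uniformity in z
  and w. The opposite signs of e cancel the first-order terms, so that the product of the two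
  integrals is 1 plus e^2 times the variance, up to higher order. The dissipation of the flow is
  exactly the form on the right of Brascamp-Lieb, with constant 1, so the rate 2 does not depend on
  \<beta>. The modulus 2 \<beta> of strong convexity acts qualitatively: it makes the Hessian
  invertible, confines w to size O(1) above, and lets the cutoff errors vanish. For \<epsilon> \<le>
  1 the tolerance is split evenly between the tilt and the chi-square part.\<close>

text \<open>Supplies cut points inside a set for the next lemma. Without a maximum, every element
  lies strictly below the supremum in \<open>ereal\<close>, so points approaching the supremum pass
  every element.\<close>

lemma ex_cofinal_incseq:
  fixes A :: "real set"
  assumes "A \<noteq> {}"
  shows "\<exists>a::nat \<Rightarrow> real. range a \<subseteq> A \<and> incseq a \<and> (\<forall>x\<in>A. \<exists>n. x \<le> a n)"
proof (cases "\<exists>m\<in>A. \<forall>x\<in>A. x \<le> m")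
  case True
  then obtain m where "m \<in> A" "\<forall>x\<in>A. x \<le> m" by blast
  then show ?thesis by (intro exI[of _ "\<lambda>_. m"]) auto
next
  case False
  have "ereal ` A \<noteq> {}" using assms by simp
  from Sup_countable_SUP[OF this] obtain f :: "nat \<Rightarrow> ereal"
    where f: "incseq f" "range f \<subseteq> ereal ` A" "Sup (ereal ` A) = (SUP i. f i)" by blast
  have "\<forall>n. \<exists>a\<in>A. f n = ereal a" using f(2) by auto
  then obtain a where a: "\<And>n. a n \<in> A" "\<And>n. f n = ereal (a n)" by metis
  have "\<exists>n. x \<le> a n" if "x \<in> A" for x
  proof -
    have "\<exists>y\<in>A. x < y" using False that by (meson not_le)
    then obtain y where "y \<in> A" "x < y" by blast
    then have "ereal x < Sup (ereal ` A)"
      by (metis SUP_upper ereal_less_eq(3) image_eqI less_ereal.simps(1) less_le_trans)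
    then obtain i where "ereal x < f i" unfolding f(3) by (auto simp: less_SUP_iff)
    then show ?thesis using a(2)[of i] by (intro exI[of _ i]) auto
  qed
  moreover have "incseq a" using f(1) a(2) by (auto simp: incseq_def)
  ultimately show ?thesis using a(1) by blast
qed

text \<open>This is Brunn-Minkowski on the line. \<open>C\<close> is any Borel set containing the
  midpoints, since the midpoints of two Borel sets need not form a Borel set. Cutting at points of
  the two sets and exhausting them replaces the usual reduction to compact sets.\<close>

lemma emeasure_lborel_midpoint:
  fixes A B C :: "real set"
  assumes [measurable]: "A \<in> sets borel" "B \<in> sets borel" "C \<in> sets borel"
    and ne: "A \<noteq> {}" "B \<noteq> {}"
    and mid: "\<And>x y. x \<in> A \<Longrightarrow> y \<in> B \<Longrightarrow> (x + y) / 2 \<in> C"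
  shows "emeasure lborel A + emeasure lborel B \<le> 2 * emeasure lborel C"
proof -
  have two_half: "2 * ennreal (1/2) = 1"
    using ennreal_mult[of 2 "1/2"] by simp
  \<comment> \<open>Averaging with a fixed point \<open>t\<close> is an affine map of slope 1/2, so
    it halves lengths.\<close>
  have half: "emeasure lborel S \<le> 2 * emeasure lborel T"
    if [measurable]: "S \<in> sets borel" "T \<in> sets borel" and st: "\<And>x. x \<in> S \<Longrightarrow> (x + t) / 2 \<in> T"
    for S T :: "real set" and t
  proof -
    have "emeasure lborel T = (\<integral>\<^sup>+x. indicator T x \<partial>lborel)" by simp
    also have "\<dots> = ennreal (1/2) * (\<integral>\<^sup>+x. indicator T (t/2 + 1/2 * x) \<partial>lborel)"
      by (subst nn_integral_real_affine[where c="1/2" and t="t/2"]) auto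
    finally have "2 * emeasure lborel T = (\<integral>\<^sup>+x. indicator T (t/2 + 1/2 * x) \<partial>lborel)"
      using two_half by (simp only: mult.assoc[symmetric] mult_1)
    moreover have "(\<integral>\<^sup>+x. indicator S x \<partial>lborel) \<le> (\<integral>\<^sup>+x. indicator T (t/2 + 1/2 * x) \<partial>lborel)"
      using st by (intro nn_integral_mono) (auto simp: indicator_def field_simps)
    ultimately show ?thesis by simp
  qed
  \<comment> \<open>The part of \<open>A\<close> below \<open>a\<close> averaged with \<open>b\<close> lies to the left of \<open>(a + b) / 2\<close>, and the
    part of \<open>B\<close> above \<open>b\<close> averaged with \<open>a\<close> lies to the right of it.\<close>
  have cut: "emeasure lborel (A \<inter> {..a}) + emeasure lborel (B \<inter> {b..}) \<le> 2 * emeasure lborel C"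
    if ab: "a \<in> A" "b \<in> B" for a b
  proof -
    let ?m = "(a + b) / 2"
    have 1: "emeasure lborel (A \<inter> {..a}) \<le> 2 * emeasure lborel (C \<inter> {..?m})"
      by (rule half[where t=b]) (use ab mid in auto)
    have "emeasure lborel (B \<inter> {b..}) \<le> 2 * emeasure lborel (C \<inter> {?m..})"
      by (rule half[where t=a]) (use ab mid[of a] in \<open>auto simp: add.commute\<close>)
    \<comment> \<open>The two halves of \<open>C\<close> share at most the point \<open>?m\<close>;
      dropping it costs a null set and makes them disjoint.\<close>
    also have "emeasure lborel (C \<inter> {?m..}) = emeasure lborel (C \<inter> {?m<..})"
    proof (rule emeasure_eq_AE)
      have "AE x in lborel. x \<noteq> ?m" by (rule AE_lborel_singleton)
      then show "AE x in lborel. (x \<in> C \<inter> {?m..}) = (x \<in> C \<inter> {?m<..})" by eventually_elim auto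
    qed auto
    finally have "emeasure lborel (A \<inter> {..a}) + emeasure lborel (B \<inter> {b..}) \<le>
        2 * emeasure lborel (C \<inter> {..?m}) + 2 * emeasure lborel (C \<inter> {?m<..})"
      using 1 by (rule add_mono[rotated])
    also have "\<dots> = 2 * emeasure lborel ((C \<inter> {..?m}) \<union> (C \<inter> {?m<..}))"
      by (subst plus_emeasure[symmetric]) (auto simp: distrib_left)
    also have "(C \<inter> {..?m}) \<union> (C \<inter> {?m<..}) = C" by auto
    finally show ?thesis .
  qed
  obtain a where a: "range a \<subseteq> A" "incseq a" "\<And>x. x \<in> A \<Longrightarrow> \<exists>n::nat. x \<le> a n"
    using ex_cofinal_incseq[OF ne(1)] by blast
  obtain b' where b': "range b' \<subseteq> uminus ` B" "incseq b'" "\<And>x. x \<in> uminus ` B \<Longrightarrow> \<exists>n::nat. x \<le> b' n"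
    using ex_cofinal_incseq[of "uminus ` B"] ne(2) by blast
  define b where "b n = - b' n" for n
  have b: "\<And>n. b n \<in> B" "\<And>m n. m \<le> n \<Longrightarrow> b n \<le> b m" "\<And>x. x \<in> B \<Longrightarrow> \<exists>n. b n \<le> x"
  proof -
    show "b n \<in> B" for n
    proof -
      have "b' n \<in> uminus ` B" using b'(1) by blast
      then show ?thesis by (auto simp: b_def)
    qed
    show "b n \<le> b m" if "m \<le> n" for m n using b'(2) that by (auto simp: b_def incseq_def)
    show "\<exists>n. b n \<le> x" if "x \<in> B" for x
      using b'(3)[of "- x"] that by (auto simp: b_def minus_le_iff)
  qed
  have "emeasure lborel A = (SUP n. emeasure lborel (A \<inter> {..a n}))"
    by (subst SUP_emeasure_incseq) (use a in \<open>auto simp: incseq_def intro!: arg_cong[where f="emeasure lborel"] intro: order_trans\<close>)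
  moreover have "emeasure lborel B = (SUP n. emeasure lborel (B \<inter> {b n..}))"
    by (subst SUP_emeasure_incseq)
       (use b in \<open>auto simp: incseq_def intro!: arg_cong[where f="emeasure lborel"] dest: order_trans[OF b(2)]\<close>)
  moreover have "(SUP n. emeasure lborel (A \<inter> {..a n})) + (SUP n. emeasure lborel (B \<inter> {b n..}))
      = (SUP n. emeasure lborel (A \<inter> {..a n}) + emeasure lborel (B \<inter> {b n..}))"
    by (subst ennreal_SUP_add)
       (use a b in \<open>auto simp: incseq_def intro!: emeasure_mono intro: order_trans dest: order_trans[OF b(2)]\<close>)
  moreover have "\<dots> \<le> 2 * emeasure lborel C"
    using a(1) b(1) by (intro SUP_least cut) auto
  ultimately show ?thesis by simp
qed

text \<open>Heights from 1 on are left out, hence the \<open>min 1\<close>: for functions with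
  supremum 1 the level sets there are empty, and the midpoint inequality for sets needs nonempty
  ones.\<close>

lemma nn_integral_eq_layer_cake:
  fixes f :: "real \<Rightarrow> real"
  assumes [measurable]: "f \<in> borel_measurable borel" and f: "\<And>x. 0 \<le> f x"
  shows "(\<integral>\<^sup>+x. ennreal (min 1 (f x)) \<partial>lborel) =
    (\<integral>\<^sup>+s. emeasure lborel {x. s < f x} * indicator {0<..<1} s \<partial>lborel)"
proof -
  have "(\<integral>\<^sup>+s. emeasure lborel {x. s < f x} * indicator {0<..<1} s \<partial>lborel)
      = (\<integral>\<^sup>+s. (\<integral>\<^sup>+x. indicator {x. s < f x} x * indicator {0<..<1} s \<partial>lborel) \<partial>lborel)"
    by (intro nn_integral_cong) (simp add: nn_integral_multc)
  also have "\<dots> = (\<integral>\<^sup>+s. (\<integral>\<^sup>+x. indicator {z. snd z < f (fst z) \<and> 0 < snd z \<and> snd z < 1} (x, s) \<partial>lborel) \<partial>lborel)"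
    by (intro nn_integral_cong) (auto simp: indicator_def)
  also have "\<dots> = (\<integral>\<^sup>+x. (\<integral>\<^sup>+s. indicator {z. snd z < f (fst z) \<and> 0 < snd z \<and> snd z < 1} (x, s) \<partial>lborel) \<partial>lborel)"
  proof (rule lborel_pair.Fubini')
    have "{z \<in> space (borel \<Otimes>\<^sub>M borel). snd z < f (fst z) \<and> 0 < snd z \<and> snd z < 1}
        \<in> sets (borel \<Otimes>\<^sub>M (borel :: real measure))"
      by measurable
    then show "(\<lambda>(x, y). indicator {z. snd z < f (fst z) \<and> 0 < snd z \<and> snd z < 1} (x, y))
        \<in> borel_measurable (lborel \<Otimes>\<^sub>M lborel)"
      by (simp add: space_pair_measure)
  qed
  also have "\<dots> = (\<integral>\<^sup>+x. ennreal (min 1 (f x)) \<partial>lborel)"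
  proof (intro nn_integral_cong)
    fix x
    have "(\<integral>\<^sup>+s. indicator {z. snd z < f (fst z) \<and> 0 < snd z \<and> snd z < 1} (x, s) \<partial>lborel)
        = (\<integral>\<^sup>+s. indicator {0<..<min 1 (f x)} s \<partial>lborel)"
      by (intro nn_integral_cong) (auto simp: indicator_def)
    then show "(\<integral>\<^sup>+s. indicator {z. snd z < f (fst z) \<and> 0 < snd z \<and> snd z < 1} (x, s) \<partial>lborel)
        = ennreal (min 1 (f x))"
      using f[of x] by (simp add: nn_integral_indicator del: nn_integral_indicator')
  qed
  finally show ?thesis ..
qed


text \<open>Boundedness makes the suprema \<open>a\<close> and \<open>b\<close> finite. The midpoint
  inequality for level sets, integrated over the heights, gives the additive form F/a + G/b \<le>
  2H/c with c^2 = ab, and the arithmetic-geometric mean inequality turns it into the product form,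
  in which \<open>a\<close> and \<open>b\<close> cancel.\<close>

lemma prekopa_leindler_real_bounded:
  fixes f g h :: "real \<Rightarrow> real"
  assumes [measurable]: "f \<in> borel_measurable borel" "g \<in> borel_measurable borel" "h \<in> borel_measurable borel"
    and nn: "\<And>x. 0 \<le> f x" "\<And>x. 0 \<le> g x" "\<And>x. 0 \<le> h x"
    and bd: "\<And>x. f x \<le> K" "\<And>x. g x \<le> K"
    and mid: "\<And>x y. f x * g y \<le> (h ((x + y) / 2))\<^sup>2"
  shows "(\<integral>\<^sup>+x. ennreal (f x) \<partial>lborel) * (\<integral>\<^sup>+x. ennreal (g x) \<partial>lborel) \<le> (\<integral>\<^sup>+x. ennreal (h x) \<partial>lborel)\<^sup>2"
proof (cases "(\<exists>x. 0 < f x) \<and> (\<exists>x. 0 < g x)")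
  case False
  then have "(\<forall>x. f x = 0) \<or> (\<forall>x. g x = 0)" using nn by (metis less_eq_real_def)
  then show ?thesis by auto
next
  case True
  define a where "a = (SUP x. f x)"
  define b where "b = (SUP x. g x)"
  define c where "c = sqrt (a * b)"
  have bdd: "bdd_above (range f)" "bdd_above (range g)" using bd by (auto intro!: bdd_aboveI)
  have fa: "f x \<le> a" and gb: "g x \<le> b" for x
    using bdd by (auto simp: a_def b_def intro: cSUP_upper)
  have pos: "0 < a" "0 < b" using True fa gb by (auto intro: less_le_trans)
  then have c: "0 < c" "c\<^sup>2 = a * b" by (auto simp: c_def)
  \<comment> \<open>Normalizing the suprema to 1 makes both level sets nonempty at every height \<open>s < 1\<close>.\<close>
  have level: "emeasure lborel {x. s < f x / a} + emeasure lborel {x. s < g x / b}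
      \<le> 2 * emeasure lborel {x. s < h x / c}" if s: "0 < s" "s < 1" for s
  proof (rule emeasure_lborel_midpoint)
    have "s * a < a" "s * b < b" using s pos by auto
    then have "\<exists>x. s * a < f x" "\<exists>x. s * b < g x"
      unfolding a_def b_def using less_cSUP_iff[OF _ bdd(1)] less_cSUP_iff[OF _ bdd(2)] by auto
    then show "{x. s < f x / a} \<noteq> {}" "{x. s < g x / b} \<noteq> {}"
      using pos by (auto simp: field_simps)
    fix x y assume "x \<in> {x. s < f x / a}" "y \<in> {x. s < g x / b}"
    then have "s * a < f x" "s * b < g y" using pos by (auto simp: field_simps)
    then have "(s * a) * (s * b) < f x * g y" using s pos
      by (intro mult_strict_mono) (auto intro: less_trans[OF mult_pos_pos])
    also have "\<dots> \<le> (h ((x + y) / 2))\<^sup>2" by (rule mid)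
    also have "(s * a) * (s * b) = (s * c)\<^sup>2"
      unfolding power_mult_distrib c(2) by (simp add: power2_eq_square)
    finally have "(s * c)\<^sup>2 < (h ((x + y) / 2))\<^sup>2" .
    then have "s * c < h ((x + y) / 2)" using nn(3) by (rule power2_less_imp_less)
    then show "(x + y) / 2 \<in> {x. s < h x / c}" using c by (simp add: field_simps)
  qed auto
  let ?I = "\<lambda>f. \<integral>\<^sup>+x. ennreal (f x) \<partial>lborel"
  let ?J = "\<lambda>f. \<integral>\<^sup>+s. emeasure lborel {x. s < f x} * indicator {0<..<1} s \<partial>lborel"
  have [measurable]: "(\<lambda>s. emeasure lborel {x. s < u x}) \<in> borel_measurable borel"
    if u[measurable]: "u \<in> borel_measurable borel" for u :: "real \<Rightarrow> real"
  proof -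
    have "{z \<in> space (borel \<Otimes>\<^sub>M borel). fst z < u (snd z)} \<in> sets (borel \<Otimes>\<^sub>M (borel :: real measure))"
      by measurable
    then have "{z. fst z < u (snd z)} \<in> sets (borel \<Otimes>\<^sub>M (lborel :: real measure))"
      by (simp add: space_pair_measure cong: sets_pair_measure_cong)
    from lborel.measurable_emeasure_Pair[OF this] show ?thesis by (simp add: vimage_def)
  qed
  have cake: "?I (\<lambda>x. min 1 (u x / k)) = ?J (\<lambda>x. u x / k)"
    if "0 < k" "\<And>x. 0 \<le> u x" "u \<in> borel_measurable borel" for u :: "real \<Rightarrow> real" and k
    using that by (intro nn_integral_eq_layer_cake) auto
  have scale: "?I (\<lambda>x. u x / k) = ennreal (1 / k) * ?I u"
    if "0 < k" "\<And>x. 0 \<le> u x" "u \<in> borel_measurable borel" for u :: "real \<Rightarrow> real" and k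
  proof -
    have "?I (\<lambda>x. u x / k) = (\<integral>\<^sup>+x. ennreal (1 / k) * ennreal (u x) \<partial>lborel)"
      using that by (intro nn_integral_cong) (simp add: ennreal_mult[symmetric])
    also have "\<dots> = ennreal (1 / k) * ?I u" using that by (intro nn_integral_cmult) auto
    finally show ?thesis .
  qed
  have "?I (\<lambda>x. f x / a) + ?I (\<lambda>x. g x / b) = ?I (\<lambda>x. min 1 (f x / a)) + ?I (\<lambda>x. min 1 (g x / b))"
    using pos fa gb by (intro arg_cong2[where f="(+)"] nn_integral_cong) (auto simp: min_absorb2)
  also have "\<dots> = ?J (\<lambda>x. f x / a) + ?J (\<lambda>x. g x / b)"
    using pos nn by (intro arg_cong2[where f="(+)"] cake) auto
  also have "\<dots> = (\<integral>\<^sup>+s. emeasure lborel {x. s < f x / a} * indicator {0<..<1} s +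
      emeasure lborel {x. s < g x / b} * indicator {0<..<1} s \<partial>lborel)"
    by (rule nn_integral_add[symmetric]) auto
  also have "\<dots> \<le> (\<integral>\<^sup>+s. 2 * (emeasure lborel {x. s < h x / c} * indicator {0<..<1} s) \<partial>lborel)"
    using level by (intro nn_integral_mono) (auto simp: indicator_def)
  also have "\<dots> = 2 * ?J (\<lambda>x. h x / c)"
    by (rule nn_integral_cmult) auto
  also have "?J (\<lambda>x. h x / c) = ?I (\<lambda>x. min 1 (h x / c))"
    using c nn by (intro cake[symmetric]) auto
  also have "2 * \<dots> \<le> 2 * ?I (\<lambda>x. h x / c)"
    by (intro mult_left_mono nn_integral_mono ennreal_leI) auto
  finally have main: "?I (\<lambda>x. f x / a) + ?I (\<lambda>x. g x / b) \<le> 2 * ?I (\<lambda>x. h x / c)" .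
  \<comment> \<open>An infinite right side is trivial; a finite one forces both integrals on the
    left to be finite, and the rest is real arithmetic.\<close>
  show ?thesis
  proof (cases "?I h = \<top>")
    case True
    then show ?thesis by (simp add: power2_eq_square)
  next
    case False
    then obtain H where H: "?I h = ennreal H" "0 \<le> H" by (cases "?I h") auto
    have m: "ennreal (1 / a) * ?I f + ennreal (1 / b) * ?I g \<le> ennreal (2 * (1 / c) * H)"
    proof -
      have "2 * (ennreal (1 / c) * ennreal H) = ennreal (2 * (1 / c) * H)"
        using c H(2) ennreal_mult[of 2 "1 / c * H"] ennreal_mult[of "1 / c" H] by (simp add: mult.assoc)
      then show ?thesis
        using main pos(1,2) c(1) nn by (simp only: scale H(1) assms(1-3))
    qed
    have "?I f \<noteq> \<top>" "?I g \<noteq> \<top>"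
      using m pos by (auto simp: ennreal_mult_top top_unique)
    then obtain F G where FG: "?I f = ennreal F" "0 \<le> F" "?I g = ennreal G" "0 \<le> G"
      by (cases "?I f"; cases "?I g") auto
    have "F / a + G / b \<le> 2 * H / c"
      using m pos c FG H by (simp add: ennreal_mult[symmetric] ennreal_plus[symmetric] del: ennreal_plus)
    then have "(F / a + G / b)\<^sup>2 \<le> (2 * H / c)\<^sup>2"
      using FG pos by (intro power_mono) auto
    moreover have "4 * (F / a * (G / b)) \<le> (F / a + G / b)\<^sup>2"
      using zero_le_power2[of "F / a - G / b"] by (simp add: power2_sum power2_diff)
    ultimately have "4 * (F / a * (G / b)) \<le> (2 * H / c)\<^sup>2" by linarith
    moreover have "4 * (F / a * (G / b)) = (4 / c\<^sup>2) * (F * G)" "(2 * H / c)\<^sup>2 = (4 / c\<^sup>2) * H\<^sup>2"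
      unfolding c(2) by (simp_all add: power_divide power_mult_distrib c(2))
    moreover have "0 < 4 / c\<^sup>2" using c(1) by simp
    ultimately have "F * G \<le> H\<^sup>2" by (metis mult_le_cancel_left_pos)
    then show ?thesis using FG H by (simp add: ennreal_mult[symmetric] ennreal_power)
  qed
qed

text \<open>Extended values are needed for the induction on the dimension, where slice integrals may
  be infinite. Truncating all three functions at one common height preserves the hypothesis: where
  \<open>h\<close> exceeds the height, the square of the height already dominates the truncated
  product.\<close>

lemma prekopa_leindler_real:
  fixes f g h :: "real \<Rightarrow> ennreal"
  assumes [measurable]: "f \<in> borel_measurable borel" "g \<in> borel_measurable borel" "h \<in> borel_measurable borel"
    and mid: "\<And>x y. f x * g y \<le> (h ((x + y) / 2))\<^sup>2"
  shows "(\<integral>\<^sup>+x. f x \<partial>lborel) * (\<integral>\<^sup>+x. g x \<partial>lborel) \<le> (\<integral>\<^sup>+x. h x \<partial>lborel)\<^sup>2"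
proof -
  let ?t = "\<lambda>u k x. min (u x) (ennreal (real k))"
  have t: "ennreal (enn2real (?t u k x)) = ?t u k x" for u :: "real \<Rightarrow> ennreal" and k x
    by (rule ennreal_enn2real) (auto simp: min_less_iff_disj)
  have trunc: "(\<integral>\<^sup>+x. ?t f k x \<partial>lborel) * (\<integral>\<^sup>+x. ?t g k x \<partial>lborel) \<le> (\<integral>\<^sup>+x. h x \<partial>lborel)\<^sup>2" for k
  proof -
    have "(\<integral>\<^sup>+x. ennreal (enn2real (?t f k x)) \<partial>lborel) * (\<integral>\<^sup>+x. ennreal (enn2real (?t g k x)) \<partial>lborel)
        \<le> (\<integral>\<^sup>+x. ennreal (enn2real (?t h k x)) \<partial>lborel)\<^sup>2"
    proof (rule prekopa_leindler_real_bounded)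
      show "enn2real (?t f k x) \<le> real k" "enn2real (?t g k x) \<le> real k" for x
        by (auto intro!: enn2real_leI)
      fix x y
      have "?t f k x * ?t g k y \<le> (?t h k ((x + y) / 2))\<^sup>2"
      proof (cases "h ((x + y) / 2) \<le> ennreal (real k)")
        case True
        then show ?thesis using order_trans[OF mult_mono mid[of x y]] by (simp add: min_absorb1)
      next
        case False
        then have "?t h k ((x + y) / 2) = ennreal (real k)" by (simp add: min_def)
        then show ?thesis by (simp add: power2_eq_square mult_mono)
      qed
      then have "ennreal (enn2real (?t f k x)) * ennreal (enn2real (?t g k y)) \<le> (ennreal (enn2real (?t h k ((x + y) / 2))))\<^sup>2"
        unfolding t .
      then show "enn2real (?t f k x) * enn2real (?t g k y) \<le> (enn2real (?t h k ((x + y) / 2)))\<^sup>2"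
        by (simp add: ennreal_mult[symmetric] ennreal_power del: t)
    qed auto
    also have "\<dots> \<le> (\<integral>\<^sup>+x. h x \<partial>lborel)\<^sup>2"
      unfolding t by (intro power_mono nn_integral_mono) auto
    finally show ?thesis unfolding t .
  qed
  have mono: "?t u i x \<le> ?t u j x" if "i \<le> j" for u :: "real \<Rightarrow> ennreal" and i j x
    using that by (intro min.mono order_refl ennreal_leI) auto
  have sup: "(\<integral>\<^sup>+x. u x \<partial>lborel) = (SUP k. \<integral>\<^sup>+x. ?t u k x \<partial>lborel)"
    if [measurable]: "u \<in> borel_measurable borel" for u :: "real \<Rightarrow> ennreal"
  proof -
    have "u x = (SUP k. ?t u k x)" for x
    proof -
      have "(SUP k. ennreal (real k)) = \<top>"
        using ennreal_SUP_of_nat_eq_top by (simp add: ennreal_of_nat_eq_real_of_nat)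
      moreover have "(SUP k. ?t u k x) = inf (u x) (SUP k. ennreal (real k))"
        unfolding inf_min[symmetric] inf_SUP ..
      ultimately show ?thesis by (metis inf_top.right_neutral)
    qed
    then have "(\<integral>\<^sup>+x. u x \<partial>lborel) = (\<integral>\<^sup>+x. (SUP k. ?t u k x) \<partial>lborel)"
      by (intro nn_integral_cong)
    also have "\<dots> = (SUP k. \<integral>\<^sup>+x. ?t u k x \<partial>lborel)"
    proof (rule nn_integral_monotone_convergence_SUP)
      show "incseq (?t u)" unfolding incseq_def le_fun_def using mono by blast
    qed measurable
    finally show ?thesis .
  qed
  \<comment> \<open>The suprema of the two factors are taken one after the other, so different
    truncation heights meet; the larger one dominates both.\<close>
  have "(\<integral>\<^sup>+x. ?t f i x \<partial>lborel) * (\<integral>\<^sup>+x. ?t g j x \<partial>lborel) \<le> (\<integral>\<^sup>+x. h x \<partial>lborel)\<^sup>2" for i j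
    by (rule order_trans[OF mult_mono trunc[of "max i j"]]) (auto intro!: nn_integral_mono mono)
  then show ?thesis
    unfolding sup[OF assms(1)] sup[OF assms(2)]
    by (subst SUP_mult_right_ennreal, intro SUP_least, subst SUP_mult_left_ennreal, intro SUP_least) auto
qed

section \<open>From the line to finite products\<close>

text \<open>Integrating out one coordinate reproduces the hypothesis on the remaining ones, by the
  one-dimensional case applied to each pair of slices. It is only required on
  \<open>extensional\<close> functions, the points of the product space, and therefore the midpoint
  is restricted to \<open>I\<close>.\<close>

lemma prekopa_leindler_PiM:
  fixes f g h :: "('i \<Rightarrow> real) \<Rightarrow> ennreal"
  assumes "finite I"
    and "f \<in> borel_measurable (PiM I (\<lambda>_. lborel))" "g \<in> borel_measurable (PiM I (\<lambda>_. lborel))"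
      "h \<in> borel_measurable (PiM I (\<lambda>_. lborel))"
    and "\<And>x y. x \<in> extensional I \<Longrightarrow> y \<in> extensional I \<Longrightarrow>
      f x * g y \<le> (h (\<lambda>i\<in>I. (x i + y i) / 2))\<^sup>2"
  shows "(\<integral>\<^sup>+x. f x \<partial>PiM I (\<lambda>_. lborel)) * (\<integral>\<^sup>+x. g x \<partial>PiM I (\<lambda>_. lborel))
    \<le> (\<integral>\<^sup>+x. h x \<partial>PiM I (\<lambda>_. lborel))\<^sup>2"
  using assms
proof (induction I arbitrary: f g h rule: finite_induct)
  case empty
  interpret product_sigma_finite "\<lambda>_::'i. lborel :: real measure" by standard
  have "(\<lambda>_. undefined) \<in> extensional ({}::'i set)" by simp
  from empty(4)[OF this this] show ?case by (simp add: PiM_empty nn_integral_count_space_finite restrict_def)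
next
  case (insert j I)
  interpret product_sigma_finite "\<lambda>_::'i. lborel :: real measure" by standard
  note [measurable] = insert.prems(1-3)
  let ?s = "\<lambda>u x. \<integral>\<^sup>+y. u (x(j := y)) \<partial>lborel"
  have meas: "?s u \<in> borel_measurable (PiM I (\<lambda>_. lborel))"
    and meas1: "x \<in> extensional I \<Longrightarrow> (\<lambda>y. u (x(j := y))) \<in> borel_measurable borel"
    if [measurable]: "u \<in> borel_measurable (PiM (insert j I) (\<lambda>_. lborel))" for u :: "('i \<Rightarrow> real) \<Rightarrow> ennreal" and x
  proof -
    show "?s u \<in> borel_measurable (PiM I (\<lambda>_. lborel))" by measurable
    assume x: "x \<in> extensional I"
    then have "x \<in> space (PiM I (\<lambda>_. lborel :: real measure))" by (simp add: space_PiM PiE_def)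
    then have "(\<lambda>y. u (x(j := y))) \<in> borel_measurable (lborel :: real measure)" by measurable
    then show "(\<lambda>y. u (x(j := y))) \<in> borel_measurable borel" by simp
  qed
  have "(\<integral>\<^sup>+x. ?s f x \<partial>PiM I (\<lambda>_. lborel)) * (\<integral>\<^sup>+x. ?s g x \<partial>PiM I (\<lambda>_. lborel))
      \<le> (\<integral>\<^sup>+x. ?s h x \<partial>PiM I (\<lambda>_. lborel))\<^sup>2"
  proof (rule insert.IH)
    fix x y :: "'i \<Rightarrow> real" assume xy: "x \<in> extensional I" "y \<in> extensional I"
    let ?z = "\<lambda>i\<in>I. (x i + y i) / 2"
    show "?s f x * ?s g y \<le> (?s h ?z)\<^sup>2"
    proof (rule prekopa_leindler_real)
      fix r s :: real
      have e: "x(j := r) \<in> extensional (insert j I)" "y(j := s) \<in> extensional (insert j I)"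
        using xy by (auto simp: extensional_def)
      have "(\<lambda>i\<in>insert j I. ((x(j := r)) i + (y(j := s)) i) / 2) = ?z(j := (r + s) / 2)"
        using insert.hyps by (auto simp: fun_eq_iff restrict_def)
      with insert.prems(4)[OF e] show "f (x(j := r)) * g (y(j := s)) \<le> (h (?z(j := (r + s) / 2)))\<^sup>2"
        by (simp only:)
    qed (rule meas1 insert.prems xy restrict_extensional)+
  qed (rule meas insert.prems)+
  then show ?case
    by (simp only: product_nn_integral_insert[OF insert.hyps(1,2) insert.prems(1)]
        product_nn_integral_insert[OF insert.hyps(1,2) insert.prems(2)]
        product_nn_integral_insert[OF insert.hyps(1,2) insert.prems(3)])
qed

theorem prekopa_leindler_midpoint:
  fixes f g h :: "'a::euclidean_space \<Rightarrow> ennreal"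
  assumes [measurable]: "f \<in> borel_measurable borel" "g \<in> borel_measurable borel" "h \<in> borel_measurable borel"
    and mid: "\<And>x y. f x * g y \<le> (h ((1/2) *\<^sub>R (x + y)))\<^sup>2"
  shows "(\<integral>\<^sup>+x. f x \<partial>lborel) * (\<integral>\<^sup>+x. g x \<partial>lborel) \<le> (\<integral>\<^sup>+x. h x \<partial>lborel)\<^sup>2"
proof -
  let ?e = "\<lambda>x::'a \<Rightarrow> real. \<Sum>b\<in>Basis. x b *\<^sub>R b"
  have e[measurable]: "?e \<in> measurable (PiM Basis (\<lambda>_. lborel)) borel" by measurable
  have "(\<integral>\<^sup>+x. f (?e x) \<partial>PiM Basis (\<lambda>_. lborel)) * (\<integral>\<^sup>+x. g (?e x) \<partial>PiM Basis (\<lambda>_. lborel))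
      \<le> (\<integral>\<^sup>+x. h (?e x) \<partial>PiM Basis (\<lambda>_. lborel))\<^sup>2"
  proof (rule prekopa_leindler_PiM)
    fix x y :: "'a \<Rightarrow> real"
    have "?e (\<lambda>i\<in>Basis. (x i + y i) / 2) = (1/2) *\<^sub>R (?e x + ?e y)"
      by (simp add: scaleR_sum_right sum.distrib[symmetric] scaleR_add_left[symmetric] add_divide_distrib cong: sum.cong)
    with mid[of "?e x" "?e y"] show "f (?e x) * g (?e y) \<le> (h (?e (\<lambda>i\<in>Basis. (x i + y i) / 2)))\<^sup>2"
      by (simp only:)
  qed (simp_all, measurable)
  moreover have "(\<integral>\<^sup>+x. u x \<partial>lborel) = (\<integral>\<^sup>+x. u (?e x) \<partial>PiM Basis (\<lambda>_. lborel))"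
    if [measurable]: "u \<in> borel_measurable borel" for u :: "'a \<Rightarrow> ennreal"
    by (subst lborel_eq) (rule nn_integral_distr, measurable)
  ultimately show ?thesis by (simp only: assms(1-3))
qed

section \<open>Gradients and Hessians\<close>

text \<open>The \<open>norm\<close> of a matrix is the Frobenius norm here, so Cauchy-Schwarz on
  each row suffices.\<close>

lemma norm_matrix_vector_mult_le:
  fixes A :: "real^'n^'m"
  shows "norm (A *v x) \<le> norm A * norm x"
proof -
  have "norm (A *v x) = L2_set (\<lambda>i. norm ((A *v x) $ i)) UNIV" by (simp add: norm_vec_def)
  also have "\<dots> \<le> L2_set (\<lambda>i. norm (A $ i) * norm x) UNIV"
    by (intro L2_set_mono) (auto simp: matrix_vector_mul_component intro: Cauchy_Schwarz_ineq2)
  also have "\<dots> = norm A * norm x"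
    by (simp add: norm_vec_def L2_set_left_distrib)
  finally show ?thesis .
qed

lemma bounded_bilinear_matrix_vector_mult:
  "bounded_bilinear ((*v) :: real^'n^'m \<Rightarrow> real^'n \<Rightarrow> real^'m)"
  by (intro bounded_bilinear.intro exI[of _ 1])
     (auto simp: matrix_vector_mult_add_rdistrib matrix_vector_right_distrib
       matrix_vector_mult_scaleR scaleR_matrix_vector_assoc[symmetric] norm_matrix_vector_mult_le)

lemmas continuous_on_matrix_vector_mult =
  bounded_bilinear.continuous_on[OF bounded_bilinear_matrix_vector_mult]
lemmas tendsto_matrix_vector_mult =
  bounded_bilinear.tendsto[OF bounded_bilinear_matrix_vector_mult]

lemma gderiv_unique:
  assumes "GDERIV f x :> D" "GDERIV f x :> D'"
  shows "D = D'"
proof -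
  have "(\<lambda>h. h \<bullet> D) = (\<lambda>h. h \<bullet> D')"
    using assms unfolding gderiv_def by (rule has_derivative_unique)
  then have "h \<bullet> D = h \<bullet> D'" for h by (rule fun_cong)
  then have "\<forall>h. h \<bullet> D = h \<bullet> D'" ..
  then show ?thesis by (rule vector_eq_ldot[THEN iffD1])
qed

lemma grad_eqI: "GDERIV f x :> D \<Longrightarrow> grad f x = D"
  unfolding grad_def by (rule the_equality) (assumption, rule gderiv_unique)

text \<open>The Riesz representative of the derivative, written in the standard basis, is the
  witness that gives the \<open>THE\<close> in \<open>grad\<close> its meaning.\<close>

lemma gderiv_grad:
  fixes f :: "'a::euclidean_space \<Rightarrow> real"
  assumes "f differentiable (at x)"
  shows "GDERIV f x :> grad f x"
proof -
  obtain f' where f': "(f has_derivative f') (at x)" using assms by (auto simp: differentiable_def)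
  then interpret bounded_linear f' by (rule has_derivative_bounded_linear)
  have "f' h = inner h (\<Sum>b\<in>Basis. f' b *\<^sub>R b)" for h
  proof -
    have "f' h = f' (\<Sum>b\<in>Basis. (h \<bullet> b) *\<^sub>R b)" by (simp add: euclidean_representation)
    also have "\<dots> = (\<Sum>b\<in>Basis. (h \<bullet> b) * f' b)"
      unfolding sum scaleR real_scaleR_def ..
    also have "\<dots> = inner h (\<Sum>b\<in>Basis. f' b *\<^sub>R b)"
      unfolding inner_sum_right inner_scaleR_right by (rule sum.cong) (simp_all add: mult.commute)
    finally show ?thesis .
  qed
  then have "f' = (\<lambda>h. inner h (\<Sum>b\<in>Basis. f' b *\<^sub>R b))" by (rule ext)
  with f' have "GDERIV f x :> (\<Sum>b\<in>Basis. f' b *\<^sub>R b)"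
    unfolding gderiv_def by (rule has_derivative_eq_rhs)
  with grad_eqI[OF this] show ?thesis by (simp only:)
qed

lemma gderiv_mult:
  assumes "GDERIV f x :> D" "GDERIV g x :> E"
  shows "GDERIV (\<lambda>x. f x * g x) x :> f x *\<^sub>R E + g x *\<^sub>R D"
  using has_derivative_mult[OF assms[unfolded gderiv_def]] unfolding gderiv_def
  by (rule has_derivative_eq_rhs) (auto simp: inner_add_right algebra_simps)

lemma gderiv_imp_continuous_on:
  fixes f :: "'a::real_inner \<Rightarrow> real"
  assumes "\<And>x. GDERIV f x :> D x"
  shows "continuous_on S f"
  using assms unfolding gderiv_def
  by (meson continuous_at_imp_continuous_on has_derivative_continuous)

lemma gderiv_along_line:
  assumes "\<And>x. GDERIV f x :> D x"
  shows "((\<lambda>r. f (z + r *\<^sub>R w)) has_real_derivative (w \<bullet> D (z + r *\<^sub>R w))) (at r)"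
proof -
  have "((\<lambda>r. z + r *\<^sub>R w) has_derivative (\<lambda>h. h *\<^sub>R w)) (at r)"
    by (auto intro!: derivative_eq_intros)
  from has_derivative_compose[OF this assms[unfolded gderiv_def]] show ?thesis
    unfolding has_field_derivative_def by (rule has_derivative_eq_rhs) auto
qed

lemma gderiv_mean_value_symmetric:
  assumes "\<And>x. GDERIV f x :> D x"
  shows "\<exists>s. \<bar>s\<bar> \<le> 1 \<and> f (z + w) - f (z - w) = 2 * (w \<bullet> D (z + s *\<^sub>R w))"
proof -
  have "\<exists>s::real. -1 < s \<and> s < 1 \<and> f (z + 1 *\<^sub>R w) - f (z + (-1) *\<^sub>R w) = (1 - (-1)) * (w \<bullet> D (z + s *\<^sub>R w))"
    by (rule MVT2) (auto intro!: gderiv_along_line assms)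
  then obtain s where s: "-1 < s" "s < 1"
      "f (z + 1 *\<^sub>R w) - f (z + (-1) *\<^sub>R w) = (1 - (-1)) * (w \<bullet> D (z + s *\<^sub>R w))" by blast
  show ?thesis by (rule exI[of _ s]) (use s in auto)
qed

context
  fixes U :: "real^'n \<Rightarrow> real"
  assumes U: "twice_continuously_differentiable U"
begin

lemma tcd_gderiv: "GDERIV U x :> grad U x"
  using U by (intro gderiv_grad) (auto simp: twice_continuously_differentiable_def)

lemma tcd_grad_derivative: "(grad U has_derivative (\<lambda>h. hessian U x *v h)) (at x)"
  using U jacobian_works[of "grad U" "at x"]
  by (auto simp: twice_continuously_differentiable_def hessian_def)

lemma tcd_hessian_continuous: "continuous_on S (hessian U)"
  using U continuous_on_subset by (auto simp: twice_continuously_differentiable_def)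

lemma tcd_grad_along_line:
  "((\<lambda>r. v \<bullet> grad U (z + r *\<^sub>R w)) has_real_derivative (v \<bullet> (hessian U (z + r *\<^sub>R w) *v w))) (at r)"
proof -
  have "((\<lambda>r. z + r *\<^sub>R w) has_derivative (\<lambda>h. h *\<^sub>R w)) (at r)"
    by (auto intro!: derivative_eq_intros)
  from has_derivative_inner_right[OF has_derivative_compose[OF this tcd_grad_derivative], of v]
  show ?thesis
    unfolding has_field_derivative_def
    by (rule has_derivative_eq_rhs) (auto simp: matrix_vector_mult_scaleR)
qed

text \<open>An equality at an intermediate point is used instead of a Taylor remainder: it can be
  estimated uniformly in \<open>z\<close>, and shrinking \<open>w\<close> recovers the Hessian at
  \<open>z\<close> itself.\<close>

lemma tcd_second_difference:
  "\<exists>s. \<bar>s\<bar> \<le> 1 \<and> U (z + w) + U (z - w) - 2 * U z = w \<bullet> (hessian U (z + s *\<^sub>R w) *v w)"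
proof -
  let ?f = "\<lambda>r. U (z + r *\<^sub>R w) + U (z + r *\<^sub>R (- w))"
  let ?f' = "\<lambda>r. w \<bullet> grad U (z + r *\<^sub>R w) + (- w) \<bullet> grad U (z + r *\<^sub>R (- w))"
  have f': "(?f has_real_derivative ?f' r) (at r)" for r
    by (intro DERIV_add gderiv_along_line tcd_gderiv)
  \<comment> \<open>Cauchy's mean value theorem against the square function brings in the factor
    \<open>2 * c\<close>. Since \<open>?f' c\<close> is a difference of directional derivatives at
    \<open>c\<close> and \<open>- c\<close>, a second mean value theorem over that interval yields
    the same factor, which cancels.\<close>
  have "\<exists>c. 0 < c \<and> c < 1 \<and> (?f 1 - ?f 0) * (2 * c) = (1\<^sup>2 - 0\<^sup>2) * ?f' c"
  proof (rule GMVT')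
    show "isCont ?f z" for z by (rule DERIV_isCont[OF f'])
    show "((\<lambda>c. c\<^sup>2) has_real_derivative 2 * c) (at c)" for c :: real
      by (auto intro!: derivative_eq_intros)
  qed (auto intro!: f' simp del: scaleR_minus_right inner_minus_left)
  then obtain c where c: "0 < c" "c < 1" "(?f 1 - ?f 0) * (2 * c) = (1\<^sup>2 - 0\<^sup>2) * ?f' c" by blast
  let ?g = "\<lambda>r. w \<bullet> grad U (z + r *\<^sub>R w)"
  have "\<exists>s. - c < s \<and> s < c \<and> ?g c - ?g (- c) = (c - (- c)) * (w \<bullet> (hessian U (z + s *\<^sub>R w) *v w))"
    by (rule MVT2) (use c in \<open>auto intro!: tcd_grad_along_line\<close>)
  then obtain s where s: "- c < s" "s < c"
    "?g c - ?g (- c) = (c - (- c)) * (w \<bullet> (hessian U (z + s *\<^sub>R w) *v w))" by blast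
  have "?f' c = ?g c - ?g (- c)" by simp
  then have "(?f 1 - ?f 0) * (2 * c) = (w \<bullet> (hessian U (z + s *\<^sub>R w) *v w)) * (2 * c)"
    using c(3) s(3) by simp
  then have "?f 1 - ?f 0 = w \<bullet> (hessian U (z + s *\<^sub>R w) *v w)" using c(1) by simp
  then show ?thesis using s c by (intro exI[of _ s]) auto
qed

text \<open>The left side is symmetric in \<open>v\<close> and \<open>w\<close>, the right side is
  not visibly so; reading it both ways yields the symmetry of the Hessian.\<close>

lemma tcd_mixed_difference:
  assumes "0 < s"
  shows "\<exists>\<xi> \<eta>. 0 < \<xi> \<and> \<xi> < s \<and> 0 < \<eta> \<and> \<eta> < s \<and>
    U (z + s *\<^sub>R v + s *\<^sub>R w) - U (z + s *\<^sub>R v) - U (z + s *\<^sub>R w) + U z =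
    s\<^sup>2 * (w \<bullet> (hessian U (z + \<xi> *\<^sub>R v + \<eta> *\<^sub>R w) *v v))"
proof -
  let ?f = "\<lambda>r. U (z + s *\<^sub>R v + r *\<^sub>R w) - U (z + r *\<^sub>R w)"
  have "\<exists>\<eta>. 0 < \<eta> \<and> \<eta> < s \<and> ?f s - ?f 0 = (s - 0) *
      (w \<bullet> grad U (z + s *\<^sub>R v + \<eta> *\<^sub>R w) - w \<bullet> grad U (z + \<eta> *\<^sub>R w))"
    by (rule MVT2) (use assms in \<open>auto intro!: DERIV_diff gderiv_along_line tcd_gderiv\<close>)
  then obtain \<eta> where \<eta>: "0 < \<eta>" "\<eta> < s" "?f s - ?f 0 = (s - 0) *
      (w \<bullet> grad U (z + s *\<^sub>R v + \<eta> *\<^sub>R w) - w \<bullet> grad U (z + \<eta> *\<^sub>R w))" by blast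
  let ?g = "\<lambda>r. w \<bullet> grad U (z + \<eta> *\<^sub>R w + r *\<^sub>R v)"
  have "\<exists>\<xi>. 0 < \<xi> \<and> \<xi> < s \<and> ?g s - ?g 0 = (s - 0) *
      (w \<bullet> (hessian U (z + \<eta> *\<^sub>R w + \<xi> *\<^sub>R v) *v v))"
    by (rule MVT2) (use assms in \<open>auto intro!: tcd_grad_along_line\<close>)
  then obtain \<xi> where \<xi>: "0 < \<xi>" "\<xi> < s" "?g s - ?g 0 = (s - 0) *
      (w \<bullet> (hessian U (z + \<eta> *\<^sub>R w + \<xi> *\<^sub>R v) *v v))" by blast
  show ?thesis
    using \<eta> \<xi> by (intro exI[of _ \<xi>] exI[of _ \<eta>]) (simp add: power2_eq_square add_ac)
qed

text \<open>\<open>hessian\<close> is the Jacobian of the gradient, so its symmetry is Schwarz's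
  theorem: by continuity of the Hessian, the mixed difference quotient tends to both sides.\<close>

lemma hessian_symmetric: "v \<bullet> (hessian U z *v w) = w \<bullet> (hessian U z *v v)"
proof -
  let ?s = "\<lambda>n. 1 / real (Suc n)"
  let ?D = "\<lambda>n. (U (z + ?s n *\<^sub>R v + ?s n *\<^sub>R w) - U (z + ?s n *\<^sub>R v) - U (z + ?s n *\<^sub>R w) + U z) / (?s n)\<^sup>2"
  have lim: "(\<lambda>n. (U (z + ?s n *\<^sub>R a + ?s n *\<^sub>R b) - U (z + ?s n *\<^sub>R a) - U (z + ?s n *\<^sub>R b) + U z) / (?s n)\<^sup>2)
      \<longlonglongrightarrow> b \<bullet> (hessian U z *v a)" for a b
  proof -
    have "\<forall>n. \<exists>\<xi> \<eta>. 0 < \<xi> \<and> \<xi> < ?s n \<and> 0 < \<eta> \<and> \<eta> < ?s n \<and>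
      U (z + ?s n *\<^sub>R a + ?s n *\<^sub>R b) - U (z + ?s n *\<^sub>R a) - U (z + ?s n *\<^sub>R b) + U z =
      (?s n)\<^sup>2 * (b \<bullet> (hessian U (z + \<xi> *\<^sub>R a + \<eta> *\<^sub>R b) *v a))"
      by (intro allI tcd_mixed_difference) simp
    then obtain \<xi> \<eta> where \<xi>\<eta>: "\<And>n. 0 < \<xi> n" "\<And>n. \<xi> n < ?s n" "\<And>n. 0 < \<eta> n" "\<And>n. \<eta> n < ?s n"
      and eq: "\<And>n. U (z + ?s n *\<^sub>R a + ?s n *\<^sub>R b) - U (z + ?s n *\<^sub>R a) - U (z + ?s n *\<^sub>R b) + U z =
      (?s n)\<^sup>2 * (b \<bullet> (hessian U (z + \<xi> n *\<^sub>R a + \<eta> n *\<^sub>R b) *v a))"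
      by metis
    have s0: "?s \<longlonglongrightarrow> 0" using LIMSEQ_inverse_real_of_nat by (simp add: inverse_eq_divide)
    have "\<xi> \<longlonglongrightarrow> 0" "\<eta> \<longlonglongrightarrow> 0"
      by (rule tendsto_sandwich[OF _ _ tendsto_const s0]; use \<xi>\<eta> in \<open>auto intro!: always_eventually less_imp_le\<close>)+
    then have "(\<lambda>n. z + \<xi> n *\<^sub>R a + \<eta> n *\<^sub>R b) \<longlonglongrightarrow> z + 0 *\<^sub>R a + 0 *\<^sub>R b"
      by (intro tendsto_intros)
    then have "(\<lambda>n. hessian U (z + \<xi> n *\<^sub>R a + \<eta> n *\<^sub>R b)) \<longlonglongrightarrow> hessian U z"
      using continuous_on_tendsto_compose[OF tcd_hessian_continuous[of UNIV], of "\<lambda>n. z + \<xi> n *\<^sub>R a + \<eta> n *\<^sub>R b"]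
      by simp
    then have "(\<lambda>n. b \<bullet> (hessian U (z + \<xi> n *\<^sub>R a + \<eta> n *\<^sub>R b) *v a)) \<longlonglongrightarrow> b \<bullet> (hessian U z *v a)"
      by (intro tendsto_inner tendsto_const tendsto_matrix_vector_mult)
    moreover have "?s n \<noteq> 0" for n by simp
    ultimately show ?thesis unfolding eq by simp
  qed
  have "U (z + a + b) - U (z + a) - U (z + b) + U z = U (z + b + a) - U (z + b) - U (z + a) + U z" for a b
    by (simp add: add.assoc add.commute[of b a])
  note swap = this
  have "?D = (\<lambda>n. (U (z + ?s n *\<^sub>R w + ?s n *\<^sub>R v) - U (z + ?s n *\<^sub>R w) - U (z + ?s n *\<^sub>R v) + U z) / (?s n)\<^sup>2)"
    by (rule ext) (subst swap, rule refl)
  then have "?D \<longlonglongrightarrow> v \<bullet> (hessian U z *v w)" using lim[of w v] by (simp only:)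
  from LIMSEQ_unique[OF this lim[of v w]] show ?thesis .
qed

text \<open>Strong convexity is expressed by second differences because that form follows for tilted
  potentials from the parallelogram identity. Both sides scale quadratically, so the constant
  survives when the increment shrinks to 0.\<close>

lemma hessian_lower_bound:
  assumes \<kappa>: "\<And>z w. \<kappa> * (norm w)\<^sup>2 \<le> U (z + w) + U (z - w) - 2 * U z"
  shows "\<kappa> * (norm w)\<^sup>2 \<le> w \<bullet> (hessian U z *v w)"
proof -
  let ?s = "\<lambda>n. 1 / real (Suc n)"
  have "\<forall>n. \<exists>r. \<bar>r\<bar> \<le> 1 \<and> \<kappa> * (norm w)\<^sup>2 \<le> w \<bullet> (hessian U (z + (r * ?s n) *\<^sub>R w) *v w)"
  proof
    fix n
    obtain r where r: "\<bar>r\<bar> \<le> 1" "U (z + ?s n *\<^sub>R w) + U (z - ?s n *\<^sub>R w) - 2 * U z =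
        (?s n *\<^sub>R w) \<bullet> (hessian U (z + r *\<^sub>R ?s n *\<^sub>R w) *v (?s n *\<^sub>R w))"
      using tcd_second_difference[of z "?s n *\<^sub>R w"] by blast
    have "(?s n)\<^sup>2 * (\<kappa> * (norm w)\<^sup>2) \<le> (?s n)\<^sup>2 * (w \<bullet> (hessian U (z + (r * ?s n) *\<^sub>R w) *v w))"
    proof -
      have "\<kappa> * (norm (?s n *\<^sub>R w))\<^sup>2 = (?s n)\<^sup>2 * (\<kappa> * (norm w)\<^sup>2)"
        by (simp add: power_divide)
      moreover have "(?s n *\<^sub>R w) \<bullet> (hessian U (z + r *\<^sub>R ?s n *\<^sub>R w) *v (?s n *\<^sub>R w))
          = (?s n)\<^sup>2 * (w \<bullet> (hessian U (z + (r * ?s n) *\<^sub>R w) *v w))"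
        unfolding matrix_vector_mult_scaleR inner_scaleR_left inner_scaleR_right scaleR_scaleR
        by (simp only: power2_eq_square mult.assoc)
      ultimately show ?thesis using \<kappa>[of "?s n *\<^sub>R w" z] unfolding r(2) by (simp only:)
    qed
    moreover have "0 < (?s n)\<^sup>2" by simp
    ultimately have "\<kappa> * (norm w)\<^sup>2 \<le> w \<bullet> (hessian U (z + (r * ?s n) *\<^sub>R w) *v w)"
      by (metis mult_le_cancel_left_pos)
    then show "\<exists>r. \<bar>r\<bar> \<le> 1 \<and> \<kappa> * (norm w)\<^sup>2 \<le> w \<bullet> (hessian U (z + (r * ?s n) *\<^sub>R w) *v w)"
      using r(1) by blast
  qed
  then obtain r where r: "\<And>n. \<bar>r n\<bar> \<le> 1"
    "\<And>n. \<kappa> * (norm w)\<^sup>2 \<le> w \<bullet> (hessian U (z + (r n * ?s n) *\<^sub>R w) *v w)" by metis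
  have s0: "?s \<longlonglongrightarrow> 0" using LIMSEQ_inverse_real_of_nat by (simp add: inverse_eq_divide)
  have "(\<lambda>n. r n * ?s n) \<longlonglongrightarrow> 0"
    by (rule Lim_null_comparison[OF _ s0]) (use r(1) in \<open>auto simp: divide_right_mono\<close>)
  then have "(\<lambda>n. z + (r n * ?s n) *\<^sub>R w) \<longlonglongrightarrow> z + 0 *\<^sub>R w" by (intro tendsto_intros)
  then have "(\<lambda>n. hessian U (z + (r n * ?s n) *\<^sub>R w)) \<longlonglongrightarrow> hessian U z"
    using continuous_on_tendsto_compose[OF tcd_hessian_continuous[of UNIV], of "\<lambda>n. z + (r n * ?s n) *\<^sub>R w"]
    by simp
  then have "(\<lambda>n. w \<bullet> (hessian U (z + (r n * ?s n) *\<^sub>R w) *v w)) \<longlonglongrightarrow> w \<bullet> (hessian U z *v w)"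
    by (intro tendsto_inner tendsto_const tendsto_matrix_vector_mult)
  then show ?thesis by (rule LIMSEQ_le_const) (use r(2) in auto)
qed

end

section \<open>The Brascamp-Lieb inequality\<close>

text \<open>Completing the square at the maximizer \<open>w = e *\<^sub>R b\<close>. With
  \<open>A *v b = a\<close> the right side is e^2 times the dual form of \<open>a\<close>, which is
  where the inverse Hessian comes from.\<close>

lemma quadratic_form_bound:
  fixes A :: "real^'n^'n"
  assumes sym: "\<And>v w. v \<bullet> (A *v w) = w \<bullet> (A *v v)" and nn: "\<And>v. 0 \<le> v \<bullet> (A *v v)"
  shows "2 * e * (w \<bullet> (A *v b)) - w \<bullet> (A *v w) \<le> e\<^sup>2 * (b \<bullet> (A *v b))"
proof -
  have "0 \<le> (w - e *\<^sub>R b) \<bullet> (A *v (w - e *\<^sub>R b))" by (rule nn)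
  also have "\<dots> = w \<bullet> (A *v w) - 2 * e * (w \<bullet> (A *v b)) + e\<^sup>2 * (b \<bullet> (A *v b))"
    using sym[of b w]
    by (simp add: matrix_vector_mult_diff_distrib matrix_vector_mult_scaleR inner_diff_left inner_diff_right
        power2_eq_square algebra_simps)
  finally show ?thesis by simp
qed

text \<open>Strong convexity beats the linear gain in \<open>w\<close> unless \<open>w = O(e)\<close>, and for such \<open>w\<close> the
  expansions of \<open>\<phi>\<close> and \<open>U\<close> are uniform in \<open>z\<close> because the support is compact.  Here, as below,
  \<open>b\<close> stands for \<open>(\<nabla>\<^sup>2U)\<^sup>-\<^sup>1 a\<close>.\<close>

lemma brascamp_lieb_pointwise:
  fixes U \<phi> :: "real^'n \<Rightarrow> real" and a b :: "real^'n \<Rightarrow> real^'n"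
  assumes U: "twice_continuously_differentiable U"
    and \<kappa>: "0 < \<kappa>" "\<And>z w. \<kappa> * (norm w)\<^sup>2 \<le> U (z + w) + U (z - w) - 2 * U z"
    and \<phi>: "\<And>x. GDERIV \<phi> x :> a x" and a: "continuous_on UNIV a"
    and supp: "\<And>x. R < norm x \<Longrightarrow> \<phi> x = 0" "\<And>x. R < norm x \<Longrightarrow> a x = 0"
    and b: "\<And>x. hessian U x *v b x = a x"
    and \<delta>: "0 < \<delta>"
  shows "\<exists>e0>0. \<forall>e. 0 < e \<longrightarrow> e < e0 \<longrightarrow> (\<forall>z w.
    e * (\<phi> (z + w) - \<phi> (z - w)) - (U (z + w) + U (z - w) - 2 * U z) \<le> e\<^sup>2 * (a z \<bullet> b z + \<delta>))"
proof -
  have Hnn: "0 \<le> v \<bullet> (hessian U x *v v)" for v x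
    using hessian_lower_bound[OF U \<kappa>(2), of v x] \<kappa>(1)
    by (meson less_imp_le mult_nonneg_nonneg order_trans zero_le_power2)
  have Gnn: "0 \<le> a x \<bullet> b x" for x
    using Hnn[of "b x" x] by (simp add: b inner_commute)
  have "bounded (a ` cball 0 R)"
    by (intro compact_imp_bounded compact_continuous_image continuous_on_subset[OF a]) auto
  then obtain L where L: "0 < L" "\<And>x. x \<in> cball 0 R \<Longrightarrow> norm (a x) \<le> L"
    by (auto simp: bounded_pos)
  then have La: "norm (a x) \<le> L" for x
    using supp(2)[of x] by (cases "R < norm x") auto
  \<comment> \<open>Beyond norm \<open>C * e\<close> the gain, at most 2 e L |w|, is below the
    convexity cost \<kappa> |w|^2.\<close>
  define C where "C = 2 * L / \<kappa>"
  have C: "0 < C" using L \<kappa> by (simp add: C_def)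
  \<comment> \<open>Replacing the intermediate points by \<open>z\<close> costs 2 C \<eta> e^2 for
    the gradient of \<open>\<phi>\<close> and C^2 \<eta> e^2 for the Hessian of \<open>U\<close>;
    together this is \<delta> e^2.\<close>
  define \<eta> where "\<eta> = \<delta> / (2 * C + C\<^sup>2)"
  have \<eta>: "0 < \<eta>" using \<delta> C by (simp add: \<eta>_def add_pos_pos)
  \<comment> \<open>Centres \<open>z\<close> of norm up to \<open>R + 1\<close> are displaced by
    less than 1, so \<open>z\<close> and the intermediate points stay in this ball.\<close>
  let ?K = "cball 0 (R + 2) :: (real^'n) set"
  have uc: "uniformly_continuous_on ?K a" "uniformly_continuous_on ?K (hessian U)"
    by (intro compact_uniformly_continuous continuous_on_subset[OF a] tcd_hessian_continuous U; simp)+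
  obtain d1 where d1: "0 < d1" "\<And>x y. x \<in> ?K \<Longrightarrow> y \<in> ?K \<Longrightarrow> dist y x < d1 \<Longrightarrow> dist (a y) (a x) < \<eta>"
    using uc(1)[unfolded uniformly_continuous_on_def, rule_format, OF \<eta>] by blast
  obtain d2 where d2: "0 < d2" "\<And>x y. x \<in> ?K \<Longrightarrow> y \<in> ?K \<Longrightarrow> dist y x < d2 \<Longrightarrow>
      dist (hessian U y) (hessian U x) < \<eta>"
    using uc(2)[unfolded uniformly_continuous_on_def, rule_format, OF \<eta>] by blast
  define e0 where "e0 = min 1 (min d1 d2) / C"
  have "0 < e0" using d1(1) d2(1) C by (simp add: e0_def)
  moreover have "e * (\<phi> (z + w) - \<phi> (z - w)) - (U (z + w) + U (z - w) - 2 * U z) \<le> e\<^sup>2 * (a z \<bullet> b z + \<delta>)"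
    if e: "0 < e" "e < e0" for e z w
  proof -
    have rhs: "0 \<le> e\<^sup>2 * (a z \<bullet> b z + \<delta>)" using Gnn[of z] \<delta> by simp
    have conv: "0 \<le> U (z + w) + U (z - w) - 2 * U z"
      using \<kappa> by (meson less_imp_le mult_nonneg_nonneg order_trans zero_le_power2)
    obtain s where s: "\<bar>s\<bar> \<le> 1" "\<phi> (z + w) - \<phi> (z - w) = 2 * (w \<bullet> a (z + s *\<^sub>R w))"
      using gderiv_mean_value_symmetric[OF \<phi>] by blast
    obtain r where r: "\<bar>r\<bar> \<le> 1" "U (z + w) + U (z - w) - 2 * U z = w \<bullet> (hessian U (z + r *\<^sub>R w) *v w)"
      using tcd_second_difference[OF U] by blast
    \<comment> \<open>In case \<open>far\<close> convexity wins, in case \<open>out\<close> both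
      values of \<open>\<phi>\<close> vanish, and only \<open>main\<close> needs the
      expansion.\<close>
    consider (far) "C * e < norm w" | (out) "norm w \<le> C * e" "R + 1 < norm z"
      | (main) "norm w \<le> C * e" "norm z \<le> R + 1" by linarith
    then show ?thesis
    proof cases
      case far
      have "e * (\<phi> (z + w) - \<phi> (z - w)) \<le> e * (2 * (norm w * L))"
        unfolding s(2) using e La
        by (intro mult_left_mono order_trans[OF norm_cauchy_schwarz]) auto
      also have "\<dots> = \<kappa> * (C * e) * norm w" using \<kappa> by (simp add: C_def)
      also have "\<dots> \<le> \<kappa> * norm w * norm w"
        using far \<kappa> by (intro mult_right_mono mult_left_mono) auto
      also have "\<dots> \<le> U (z + w) + U (z - w) - 2 * U z"
        using \<kappa>(2)[of w z] by (simp add: power2_eq_square mult.assoc)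
      finally show ?thesis using rhs by linarith
    next
      case out
      have "C * e < 1" using e C by (simp add: e0_def field_simps min_less_iff_disj)
      then have "R < norm (z + w)" "R < norm (z - w)"
        using out norm_triangle_ineq2[of z "- w"] norm_triangle_ineq2[of z w] by auto
      then show ?thesis using supp(1) conv rhs by simp
    next
      case main
      have Ce: "C * e < 1" "C * e < d1" "C * e < d2"
        using e C by (auto simp: e0_def field_simps)
      have near: "z \<in> ?K" "z + t *\<^sub>R w \<in> ?K" "dist (z + t *\<^sub>R w) z \<le> C * e" if "\<bar>t\<bar> \<le> 1" for t
      proof -
        have "norm (t *\<^sub>R w) \<le> 1 * norm w" unfolding norm_scaleR using that by (rule mult_right_mono) simp
        then have t: "norm (t *\<^sub>R w) \<le> C * e" using main by simp
        then show "z \<in> ?K" "z + t *\<^sub>R w \<in> ?K" "dist (z + t *\<^sub>R w) z \<le> C * e"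
          using main Ce norm_triangle_ineq[of z "t *\<^sub>R w"]
          by (auto simp: mem_cball_0 dist_norm simp del: mem_cball)
      qed
      have "norm (a (z + s *\<^sub>R w) - a z) \<le> \<eta>"
        using d1(2)[of z "z + s *\<^sub>R w"] near[OF s(1)] Ce by (simp add: dist_norm)
      then have "w \<bullet> (a (z + s *\<^sub>R w) - a z) \<le> C * e * \<eta>"
        using main C e by (intro order_trans[OF norm_cauchy_schwarz] mult_mono) auto
      then have "w \<bullet> a (z + s *\<^sub>R w) \<le> w \<bullet> a z + C * e * \<eta>" by (simp add: inner_diff_right)
      then have A: "e * (\<phi> (z + w) - \<phi> (z - w)) \<le> 2 * e * (w \<bullet> a z) + e\<^sup>2 * (2 * C * \<eta>)"
        unfolding s(2) using e mult_left_mono[of "w \<bullet> a (z + s *\<^sub>R w)" "w \<bullet> a z + C * e * \<eta>" "2 * e"]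
        by (simp add: power2_eq_square algebra_simps)
      let ?D = "hessian U z - hessian U (z + r *\<^sub>R w)"
      have "norm ?D \<le> \<eta>"
        using d2(2)[of z "z + r *\<^sub>R w"] near[OF r(1)] Ce by (simp add: dist_norm norm_minus_commute)
      then have "norm (?D *v w) \<le> \<eta> * norm w"
        by (intro order_trans[OF norm_matrix_vector_mult_le] mult_right_mono) auto
      then have "w \<bullet> (?D *v w) \<le> norm w * (\<eta> * norm w)"
        by (intro order_trans[OF norm_cauchy_schwarz] mult_left_mono) auto
      also have "\<dots> \<le> (C * e) * (\<eta> * (C * e))"
        using main \<eta> C e by (intro mult_mono) auto
      finally have B: "w \<bullet> (hessian U z *v w) - e\<^sup>2 * (C\<^sup>2 * \<eta>) \<le> U (z + w) + U (z - w) - 2 * U z"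
        unfolding r(2) by (simp add: matrix_vector_mult_diff_rdistrib inner_diff_right power2_eq_square mult_ac)
      have "2 * e * (w \<bullet> a z) - w \<bullet> (hessian U z *v w) \<le> e\<^sup>2 * (a z \<bullet> b z)"
        using quadratic_form_bound[of "hessian U z" e w "b z", OF hessian_symmetric[OF U] Hnn]
        by (simp add: b inner_commute)
      moreover have "(2 * C + C\<^sup>2) * \<eta> = \<delta>"
      proof -
        have "2 * C + C\<^sup>2 \<noteq> 0" using C by (smt (verit) zero_less_power)
        then show ?thesis by (simp add: \<eta>_def)
      qed
      then have "e\<^sup>2 * (2 * C * \<eta>) + e\<^sup>2 * (C\<^sup>2 * \<eta>) = e\<^sup>2 * \<delta>"
        by (metis distrib_left distrib_right)
      ultimately show ?thesis using A B by (simp add: distrib_left)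
    qed
  qed
  ultimately show ?thesis by blast
qed

text \<open>The constant is 3/2 from exp 1 \<le> 3, rounded up to 2.\<close>

lemma exp_quadratic_lower:
  fixes u :: real
  assumes "\<bar>u\<bar> \<le> 1"
  shows "1 + u + u\<^sup>2 / 2 - 2 * \<bar>u\<bar> ^ 3 \<le> exp u"
proof -
  have "\<bar>exp u - (1 + u + u\<^sup>2 / 2)\<bar> \<le> exp \<bar>u\<bar> * \<bar>u\<bar> ^ 3 / 2"
    using Taylor_exp_field[of u 2] by (simp add: numeral_eq_Suc add_ac)
  also have "\<dots> \<le> 3 * \<bar>u\<bar> ^ 3 / 2"
    using assms exp_le by (intro divide_right_mono mult_right_mono order_trans[OF _ exp_le]) auto
  finally show ?thesis using zero_le_power[of "\<bar>u\<bar>" 3] by linarith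
qed

text \<open>First order suffices above, since the exponent it is applied to is itself
  O(e^2).\<close>

lemma exp_quadratic_upper:
  fixes u :: real
  assumes "\<bar>u\<bar> \<le> 1"
  shows "exp u \<le> 1 + u + 3 * u\<^sup>2"
proof -
  have "\<bar>exp u - (1 + u)\<bar> \<le> exp \<bar>u\<bar> * \<bar>u\<bar>\<^sup>2"
    using Taylor_exp_field[of u 1] by (simp add: numeral_eq_Suc add_ac)
  also have "\<dots> \<le> 3 * \<bar>u\<bar>\<^sup>2"
    using assms by (intro mult_right_mono order_trans[OF _ exp_le]) auto
  finally show ?thesis by simp
qed

lemma sets_gibbs [measurable_cong, simp]: "sets (gibbs U) = sets borel"
  by (simp add: gibbs_def)

lemma space_gibbs [simp]: "space (gibbs U) = UNIV"
  by (simp add: gibbs_def)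

lemma nn_integral_gibbs:
  assumes "U \<in> borel_measurable borel" "f \<in> borel_measurable borel"
  shows "(\<integral>\<^sup>+x. f x \<partial>gibbs U) = (\<integral>\<^sup>+x. ennreal (exp (- U x)) * f x \<partial>lborel)"
  unfolding gibbs_def using assms by (subst nn_integral_density) auto

lemma integrable_gibbs_iff:
  fixes f :: "'a::euclidean_space \<Rightarrow> real"
  assumes "U \<in> borel_measurable borel" "f \<in> borel_measurable borel"
  shows "integrable (gibbs U) f \<longleftrightarrow> integrable lborel (\<lambda>x. exp (- U x) * f x)"
  unfolding gibbs_def using assms by (subst integrable_density) auto

lemma integral_gibbs:
  fixes f :: "'a::euclidean_space \<Rightarrow> real"
  assumes "U \<in> borel_measurable borel" "f \<in> borel_measurable borel"
  shows "(\<integral>x. f x \<partial>gibbs U) = (\<integral>x. exp (- U x) * f x \<partial>lborel)"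
  unfolding gibbs_def using assms by (subst integral_density) auto

text \<open>Compact support bounds \<open>\<phi>\<close> and \<open>a x \<bullet> b x\<close>, so
  all exponential moments exist and their expansions have uniform remainders. Comparing the
  coefficients of e^2 gives the claim up to \<open>\<delta>\<close>, which is removed last.\<close>

lemma brascamp_lieb_compact_support:
  fixes U \<phi> :: "real^'n \<Rightarrow> real" and a b :: "real^'n \<Rightarrow> real^'n"
  assumes U: "twice_continuously_differentiable U" and prob: "prob_space (gibbs U)"
    and \<kappa>: "0 < \<kappa>" "\<And>z w. \<kappa> * (norm w)\<^sup>2 \<le> U (z + w) + U (z - w) - 2 * U z"
    and \<phi>: "\<And>x. GDERIV \<phi> x :> a x" and a: "continuous_on UNIV a"
    and supp: "\<And>x. R < norm x \<Longrightarrow> \<phi> x = 0" "\<And>x. R < norm x \<Longrightarrow> a x = 0"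
    and b: "\<And>x. hessian U x *v b x = a x" "continuous_on UNIV b"
  shows "(\<integral>x. (\<phi> x)\<^sup>2 \<partial>gibbs U) - (\<integral>x. \<phi> x \<partial>gibbs U)\<^sup>2 \<le> (\<integral>x. a x \<bullet> b x \<partial>gibbs U)"
proof -
  interpret prob_space "gibbs U" by (rule prob)
  have U_cont: "continuous_on UNIV U" by (rule gderiv_imp_continuous_on[OF tcd_gderiv[OF U]])
  have \<phi>_cont: "continuous_on UNIV \<phi>" by (rule gderiv_imp_continuous_on[OF \<phi>])
  have [measurable]: "U \<in> borel_measurable borel" "\<phi> \<in> borel_measurable borel"
    "a \<in> borel_measurable borel" "b \<in> borel_measurable borel"
    by (intro borel_measurable_continuous_onI U_cont \<phi>_cont a b(2))+
  have bnd: "\<exists>M\<ge>1. \<forall>x. \<bar>g x\<bar> \<le> M"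
    if "continuous_on UNIV g" "\<And>x. R < norm x \<Longrightarrow> g x = 0" for g :: "real^'n \<Rightarrow> real"
  proof -
    have "bounded (g ` cball 0 R)"
      by (intro compact_imp_bounded compact_continuous_image continuous_on_subset[OF that(1)]) auto
    then obtain M where "\<forall>y\<in>g ` cball 0 R. norm y \<le> M" unfolding bounded_iff by blast
    then have M: "norm (g x) \<le> M" if "x \<in> cball 0 R" for x using that by blast
    have "\<bar>g x\<bar> \<le> max 1 M" for x
      using M[of x] that(2)[of x] by (cases "R < norm x") auto
    then show ?thesis by (intro exI[of _ "max 1 M"]) auto
  qed
  obtain m0 where m0: "1 \<le> m0" "\<And>x. \<bar>\<phi> x\<bar> \<le> m0" using bnd[OF \<phi>_cont supp(1)] by blast
  have "\<exists>M\<ge>1. \<forall>x. \<bar>a x \<bullet> b x\<bar> \<le> M"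
    using supp(2) by (intro bnd continuous_on_inner a b(2)) auto
  then obtain M where M: "1 \<le> M" "\<And>x. \<bar>a x \<bullet> b x\<bar> \<le> M" by blast
  have Gnn: "0 \<le> a x \<bullet> b x" for x
    using hessian_lower_bound[OF U \<kappa>(2), of "b x" x] \<kappa>(1)
    by (simp add: b inner_commute) (meson less_imp_le mult_nonneg_nonneg order_trans zero_le_power2)
  have int_bdd: "integrable (gibbs U) g" if "g \<in> borel_measurable borel" "\<And>x. \<bar>g x\<bar> \<le> K" for g and K :: real
    using that by (intro integrable_const_bound[of _ K]) auto
  define c where "c = (\<integral>x. \<phi> x \<partial>gibbs U)"
  \<comment> \<open>Both exponential moments of the centred function are at least the same \<open>D\<close> below, so the
    product of the two integrals never has to be expanded.\<close>
  define \<psi> where "\<psi> x = \<phi> x - c" for x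
  have [measurable]: "\<psi> \<in> borel_measurable borel" unfolding \<psi>_def by measurable
  define m where "m = m0 + \<bar>c\<bar>"
  have m: "1 \<le> m" "\<bar>\<psi> x\<bar> \<le> m" for x
    using m0(1) m0(2)[of x] by (auto simp: m_def \<psi>_def)
  have i\<phi>: "integrable (gibbs U) \<phi>" by (rule int_bdd[OF _ m0(2)]) measurable
  have i\<psi>: "integrable (gibbs U) \<psi>" by (rule int_bdd[OF _ m(2)]) measurable
  have sq: "u\<^sup>2 \<le> K\<^sup>2" if "\<bar>u\<bar> \<le> K" for u K :: real
    using power_mono[OF that, of 2] by simp
  have i\<phi>2: "integrable (gibbs U) (\<lambda>x. (\<phi> x)\<^sup>2)"
    by (rule int_bdd[of _ "m0\<^sup>2"]) (use sq[OF m0(2)] in auto)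
  have i\<psi>2: "integrable (gibbs U) (\<lambda>x. (\<psi> x)\<^sup>2)"
    by (rule int_bdd[of _ "m\<^sup>2"]) (use sq[OF m(2)] in auto)
  have iG: "integrable (gibbs U) (\<lambda>x. a x \<bullet> b x)" by (rule int_bdd[OF _ M(2)]) measurable
  have E\<psi>: "(\<integral>x. \<psi> x \<partial>gibbs U) = 0"
    using i\<phi> prob_space unfolding \<psi>_def by (simp add: c_def)
  define v where "v = (\<integral>x. (\<psi> x)\<^sup>2 \<partial>gibbs U)"
  have v_eq: "v = (\<integral>x. (\<phi> x)\<^sup>2 \<partial>gibbs U) - c\<^sup>2"
  proof -
    have "v = (\<integral>x. (\<phi> x)\<^sup>2 - 2 * c * \<phi> x + c\<^sup>2 \<partial>gibbs U)"
      unfolding v_def \<psi>_def by (intro Bochner_Integration.integral_cong refl) (simp add: power2_diff)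
    also have "\<dots> = (\<integral>x. (\<phi> x)\<^sup>2 \<partial>gibbs U) - 2 * c * c + c\<^sup>2"
      using i\<phi> i\<phi>2 prob_space by (simp add: c_def[symmetric])
    finally show ?thesis by (simp add: power2_eq_square)
  qed
  have main: "v \<le> (\<integral>x. a x \<bullet> b x \<partial>gibbs U) + \<delta>" if \<delta>: "0 < \<delta>" for \<delta>
  proof -
    let ?EG = "\<integral>x. a x \<bullet> b x \<partial>gibbs U"
    have "\<exists>e0>0. \<forall>e. 0 < e \<longrightarrow> e < e0 \<longrightarrow> (\<forall>z w.
        e * (\<phi> (z + w) - \<phi> (z - w)) - (U (z + w) + U (z - w) - 2 * U z) \<le> e\<^sup>2 * (a z \<bullet> b z + \<delta>))"
      by (rule brascamp_lieb_pointwise[OF U \<kappa> \<phi> a _ _ b(1) \<delta>, where R=R]) (fact supp)+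
    then obtain e0 where e0: "0 < e0" and pw': "\<forall>e. 0 < e \<longrightarrow> e < e0 \<longrightarrow> (\<forall>z w.
        e * (\<phi> (z + w) - \<phi> (z - w)) - (U (z + w) + U (z - w) - 2 * U z) \<le> e\<^sup>2 * (a z \<bullet> b z + \<delta>))"
      by (elim exE conjE) (rule that)
    note pw = pw'[rule_format]
    define K where "K = M + \<delta>"
    have K: "1 \<le> K" using M \<delta> by (simp add: K_def)
    \<comment> \<open>This keeps both exponents, of sizes e m and e^2 K, within the range [-1, 1] of
      the two exponential estimates.\<close>
    define e1 where "e1 = min e0 (1 / (m + K))"
    have e1: "0 < e1" using e0 m K by (simp add: e1_def)
    \<comment> \<open>Multiplied by 2 / e^2, the cubic remainder 2 (e m)^3 becomes 4 e m^3, and 3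
      (e^2 K)^2 becomes 6 e^2 K^2, which is at most 6 e K^2 because e \<le> 1.\<close>
    have step: "v \<le> ?EG + \<delta> + e * (4 * m ^ 3 + 6 * K\<^sup>2)" if e: "0 < e" "e < e1" for e
    proof -
      have em: "e * m \<le> 1" "e * K \<le> 1" "e \<le> 1" "e < e0"
      proof -
        have "e * (m + K) < 1" using e m(1) K by (simp add: e1_def field_simps)
        moreover have "0 \<le> e * m" "0 \<le> e * K" "e * 1 \<le> e * m" using e m(1) K by auto
        ultimately show "e * m \<le> 1" "e * K \<le> 1" "e \<le> 1" by (auto simp: distrib_left)
        show "e < e0" using e by (simp add: e1_def)
      qed
      have ue: "\<bar>t * \<psi> x\<bar> \<le> e * m" if "\<bar>t\<bar> = e" for t x
        using that m(2)[of x] e by (simp add: abs_mult mult_left_mono)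
      \<comment> \<open>Half of the pointwise bound, because the function at the midpoint enters
        squared. Centring \<open>\<phi>\<close> leaves that bound intact: the constant
        \<open>c\<close> cancels in the difference of two values.\<close>
      define q where "q x = e\<^sup>2 / 2 * (a x \<bullet> b x + \<delta>)" for x
      have [measurable]: "q \<in> borel_measurable borel" unfolding q_def by measurable
      have q: "0 \<le> q x" "q x \<le> e\<^sup>2 * K" "q x \<le> 1" for x
      proof -
        have G: "0 \<le> a x \<bullet> b x + \<delta>" "a x \<bullet> b x + \<delta> \<le> K"
          using Gnn[of x] M(2)[of x] \<delta> by (auto simp: K_def)
        then show "0 \<le> q x" by (simp add: q_def)
        have "q x \<le> e\<^sup>2 * (a x \<bullet> b x + \<delta>)" using G by (simp add: q_def mult_right_mono)
        also have "\<dots> \<le> e\<^sup>2 * K" using G by (intro mult_left_mono) auto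
        finally show "q x \<le> e\<^sup>2 * K" .
        also have "\<dots> \<le> 1" using mult_mono[OF em(3) em(2)] e K by (simp add: power2_eq_square mult.assoc)
        finally show "q x \<le> 1" .
      qed
      let ?P = "\<lambda>t. \<integral>x. exp (t * \<psi> x) \<partial>gibbs U"
      let ?Q = "\<integral>x. exp (q x) \<partial>gibbs U"
      have iP: "integrable (gibbs U) (\<lambda>x. exp (t * \<psi> x))" if "\<bar>t\<bar> = e" for t
      proof (rule int_bdd[of _ "exp 1"])
        fix x show "\<bar>exp (t * \<psi> x)\<bar> \<le> exp 1" using ue[OF that, of x] em(1) by simp
      qed measurable
      have iQ: "integrable (gibbs U) (\<lambda>x. exp (q x))"
        by (rule int_bdd[of _ "exp 1"]) (use q in auto)
      have nn: "(\<integral>\<^sup>+x. ennreal (exp (g x - U x)) \<partial>lborel) = ennreal (\<integral>x. exp (g x) \<partial>gibbs U)"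
        if [measurable]: "g \<in> borel_measurable borel" and "integrable (gibbs U) (\<lambda>x. exp (g x))" for g
      proof -
        have "(\<integral>\<^sup>+x. ennreal (exp (g x - U x)) \<partial>lborel) = (\<integral>\<^sup>+x. ennreal (exp (g x)) \<partial>gibbs U)"
          by (subst nn_integral_gibbs)
             (auto simp: ennreal_mult[symmetric] exp_add[symmetric] intro!: nn_integral_cong)
        also have "\<dots> = ennreal (\<integral>x. exp (g x) \<partial>gibbs U)"
          using that by (intro nn_integral_eq_integral) auto
        finally show ?thesis .
      qed
      have "(\<integral>\<^sup>+x. ennreal (exp (e * \<psi> x - U x)) \<partial>lborel) * (\<integral>\<^sup>+x. ennreal (exp (- e * \<psi> x - U x)) \<partial>lborel)
          \<le> (\<integral>\<^sup>+x. ennreal (exp (q x - U x)) \<partial>lborel)\<^sup>2"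
      proof (rule prekopa_leindler_midpoint)
        fix x y :: "real^'n"
        define z where "z = (1/2) *\<^sub>R (x + y)"
        define w where "w = (1/2) *\<^sub>R (x - y)"
        have zw: "z + w = x" "z - w = y"
          unfolding z_def w_def by (simp_all add: scaleR_add_right[symmetric] scaleR_diff_right[symmetric] scaleR_2[symmetric])
        have "(e * \<psi> x - U x) + (- e * \<psi> y - U y) \<le> 2 * (q z - U z)"
          using pw[OF e(1) em(4), of z w] unfolding zw q_def \<psi>_def by (simp add: algebra_simps)
        then show "ennreal (exp (e * \<psi> x - U x)) * ennreal (exp (- e * \<psi> y - U y))
            \<le> (ennreal (exp (q ((1/2) *\<^sub>R (x + y)) - U ((1/2) *\<^sub>R (x + y)))))\<^sup>2"
          unfolding z_def[symmetric]
          by (simp add: ennreal_mult[symmetric] ennreal_power exp_add[symmetric] exp_double[symmetric])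
      qed measurable
      then have "ennreal (?P e) * ennreal (?P (- e)) \<le> (ennreal ?Q)\<^sup>2"
        using e iP[of e] iP[of "- e"] iQ by (subst (asm) (1 2 3) nn) auto
      then have PPQ: "?P e * ?P (- e) \<le> ?Q\<^sup>2"
        by (simp add: ennreal_mult[symmetric] ennreal_power)
      \<comment> \<open>The linear term is missing because \<open>\<psi>\<close> has mean 0, so one
        lower bound serves both signs of \<open>t\<close>.\<close>
      define D where "D = 1 + e\<^sup>2 * v / 2 - 2 * (e * m) ^ 3"
      have DP: "D \<le> ?P t" if t: "\<bar>t\<bar> = e" for t
      proof -
        have t2: "t\<^sup>2 = e\<^sup>2" using t by (metis power2_abs)
        have "D = (\<integral>x. (1 - 2 * (e * m) ^ 3) + t * \<psi> x + t\<^sup>2 / 2 * (\<psi> x)\<^sup>2 \<partial>gibbs U)"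
          using i\<psi> i\<psi>2 E\<psi> prob_space by (simp add: D_def v_def t2)
        also have "\<dots> \<le> ?P t"
        proof (rule integral_mono)
          fix x
          have "\<bar>t * \<psi> x\<bar> ^ 3 \<le> (e * m) ^ 3" using ue[OF t] by (intro power_mono) auto
          moreover have "1 + t * \<psi> x + (t * \<psi> x)\<^sup>2 / 2 - 2 * \<bar>t * \<psi> x\<bar> ^ 3 \<le> exp (t * \<psi> x)"
            using ue[OF t, of x] em(1) by (intro exp_quadratic_lower) simp
          ultimately show "1 - 2 * (e * m) ^ 3 + t * \<psi> x + t\<^sup>2 / 2 * (\<psi> x)\<^sup>2 \<le> exp (t * \<psi> x)"
            by (simp add: power_mult_distrib)
        qed (use i\<psi> i\<psi>2 iP[OF t] in auto)
        finally show ?thesis .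
      qed
      have Qle: "?Q \<le> 1 + e\<^sup>2 / 2 * (?EG + \<delta>) + 3 * (e\<^sup>2 * K)\<^sup>2"
      proof -
        have "?Q \<le> (\<integral>x. 1 + q x + 3 * (e\<^sup>2 * K)\<^sup>2 \<partial>gibbs U)"
        proof (rule integral_mono[OF iQ])
          fix x
          have "exp (q x) \<le> 1 + q x + 3 * (q x)\<^sup>2" using q[of x] by (intro exp_quadratic_upper) auto
          also have "(q x)\<^sup>2 \<le> (e\<^sup>2 * K)\<^sup>2" using q[of x] by (intro power_mono) auto
          finally show "exp (q x) \<le> 1 + q x + 3 * (e\<^sup>2 * K)\<^sup>2" by simp
        qed (use iG in \<open>simp add: q_def\<close>)
        also have "\<dots> = 1 + e\<^sup>2 / 2 * (?EG + \<delta>) + 3 * (e\<^sup>2 * K)\<^sup>2"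
          using iG prob_space by (simp add: q_def)
        finally show ?thesis .
      qed
      have Q0: "0 \<le> ?Q" by (intro integral_nonneg_AE) auto
      \<comment> \<open>Passing from squares back to \<open>D\<close> needs \<open>D\<close>
        nonnegative; a negative \<open>D\<close> is trivially below \<open>?Q\<close>.\<close>
      have "D \<le> ?Q"
      proof (cases "0 \<le> D")
        case True
        have "D\<^sup>2 \<le> ?P e * ?P (- e)"
          unfolding power2_eq_square using DP[of e] DP[of "- e"] e True by (intro mult_mono) auto
        then have "D\<^sup>2 \<le> ?Q\<^sup>2" using PPQ by linarith
        then show ?thesis using Q0 by (rule power2_le_imp_le)
      next
        case False
        then show ?thesis using Q0 by linarith
      qed
      then have "e\<^sup>2 * v / 2 \<le> e\<^sup>2 / 2 * (?EG + \<delta>) + 3 * (e\<^sup>2 * K)\<^sup>2 + 2 * (e * m) ^ 3"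
        using Qle unfolding D_def by linarith
      then have "e\<^sup>2 * v \<le> e\<^sup>2 * (?EG + \<delta> + 6 * e\<^sup>2 * K\<^sup>2 + 4 * e * m ^ 3)"
        by (simp add: power2_eq_square power3_eq_cube field_simps)
      then have "v \<le> ?EG + \<delta> + 6 * e\<^sup>2 * K\<^sup>2 + 4 * e * m ^ 3" using e by simp
      also have "6 * e\<^sup>2 * K\<^sup>2 \<le> e * (6 * K\<^sup>2)"
        using e em(3) by (simp add: power2_eq_square mult_left_le_one_le mult_right_mono)
      finally show ?thesis by (simp add: algebra_simps)
    qed
    show ?thesis
    proof (rule field_le_epsilon)
      fix r :: real assume r: "0 < r"
      let ?A = "4 * m ^ 3 + 6 * K\<^sup>2"
      have A: "0 < ?A" using m(1) K by (simp add: add_pos_pos)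
      define e where "e = min (e1 / 2) (r / ?A)"
      have "0 < e" using e1 r A by (simp add: e_def)
      moreover have "e \<le> e1 / 2" unfolding e_def by (rule min.cobounded1)
      then have "e < e1" using e1 by linarith
      moreover have "e \<le> r / ?A" unfolding e_def by (rule min.cobounded2)
      then have "e * ?A \<le> r" using A by (simp only: pos_le_divide_eq)
      ultimately show "v \<le> ?EG + \<delta> + r" using step[of e] by linarith
    qed
  qed
  have "v \<le> (\<integral>x. a x \<bullet> b x \<partial>gibbs U)" by (rule field_le_epsilon) (rule main)
  then show ?thesis unfolding v_eq c_def .
qed

section \<open>Inverse Hessians and removal of the compact support\<close>

text \<open>This coercivity estimate serves three purposes: invertibility of the Hessian, continuity
  of solutions, and the size of the inverse Hessian applied to the cutoff gradient.\<close>

lemma matrix_vector_mult_norm_lower_bound: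
  fixes A :: "real^'n^'n"
  assumes "\<And>v. \<kappa> * (norm v)\<^sup>2 \<le> v \<bullet> (A *v v)"
  shows "\<kappa> * norm v \<le> norm (A *v v)"
proof (cases "v = 0")
  case False
  have "\<kappa> * norm v * norm v \<le> v \<bullet> (A *v v)"
    using assms[of v] by (simp add: power2_eq_square mult.assoc)
  also have "\<dots> \<le> norm (A *v v) * norm v"
    using norm_cauchy_schwarz[of v "A *v v"] by (simp add: mult.commute)
  finally show ?thesis using False by simp
qed simp

lemma positive_definite_matrix_inv:
  fixes A :: "real^'n^'n"
  assumes "0 < \<kappa>" "\<And>v. \<kappa> * (norm v)\<^sup>2 \<le> v \<bullet> (A *v v)"
  shows "A *v (matrix_inv A *v y) = y"
proof -
  have "inj ((*v) A)"
  proof (rule injI)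
    fix v w assume "A *v v = A *v w"
    then have "\<kappa> * norm (v - w) \<le> 0"
      using matrix_vector_mult_norm_lower_bound[OF assms(2), of "v - w"]
      by (simp add: matrix_vector_mult_diff_distrib)
    then show "v = w" using assms(1) by (simp add: mult_le_0_iff)
  qed
  then have "invertible A"
    by (simp add: matrix_left_invertible_injective invertible_left_inverse)
  then have "A ** matrix_inv A = mat 1"
    unfolding invertible_def matrix_inv_def by (rule someI2_ex) simp
  then show ?thesis by (simp add: matrix_vector_mul_assoc)
qed

text \<open>Continuity of matrix inversion is bypassed: H(y) (b y - b x) = a y - H(y) b x tends to 0
  as y tends to x, and coercivity transfers this to b y - b x.\<close>

lemma hessian_solution_continuous:
  fixes U :: "real^'n \<Rightarrow> real"
  assumes U: "twice_continuously_differentiable U"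
    and \<kappa>: "0 < \<kappa>" "\<And>x v. \<kappa> * (norm v)\<^sup>2 \<le> v \<bullet> (hessian U x *v v)"
    and a: "continuous_on UNIV a" and b: "\<And>x. hessian U x *v b x = a x"
  shows "continuous_on UNIV b"
proof -
  have "isCont b x" for x
  proof -
    have "((\<lambda>y. a y - hessian U y *v b x) \<longlongrightarrow> a x - hessian U x *v b x) (at x)"
      using a tcd_hessian_continuous[OF U, of UNIV]
      by (intro tendsto_diff tendsto_matrix_vector_mult tendsto_const)
         (auto simp: continuous_on_eq_continuous_at isCont_def)
    then have "((\<lambda>y. norm (a y - hessian U y *v b x) / \<kappa>) \<longlongrightarrow> 0) (at x)"
      by (intro tendsto_divide_zero tendsto_norm_zero) (simp add: b)
    moreover have "norm (b y - b x) \<le> norm (a y - hessian U y *v b x) / \<kappa>" for y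
      using matrix_vector_mult_norm_lower_bound[OF \<kappa>(2), of "b y - b x" y] \<kappa>(1)
      by (simp add: matrix_vector_mult_diff_distrib b field_simps)
    then have "\<forall>\<^sub>F y in at x. norm (b y - b x) \<le> norm (a y - hessian U y *v b x) / \<kappa>"
      by (intro always_eventually allI)
    ultimately have "((\<lambda>y. b y - b x) \<longlongrightarrow> 0) (at x)"
      by (rule Lim_null_comparison[rotated])
    then show ?thesis by (simp add: isCont_def LIM_zero_cancel)
  qed
  then show ?thesis by (simp add: continuous_on_eq_continuous_at)
qed

text \<open>Young's inequality with a free weight. With r equal to the cutoff radius R, the main
  term keeps a factor tending to 1, and the factor 1 + R of the cutoff term is beaten by the R^-2 of
  the squared cutoff gradient.\<close>

lemma quadratic_form_add_le:
  fixes A :: "real^'n^'n"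
  assumes sym: "\<And>v w. v \<bullet> (A *v w) = w \<bullet> (A *v v)" and nn: "\<And>v. 0 \<le> v \<bullet> (A *v v)" and r: "0 < r"
  shows "(v + w) \<bullet> (A *v (v + w)) \<le> (1 + 1 / r) * (v \<bullet> (A *v v)) + (1 + r) * (w \<bullet> (A *v w))"
proof -
  have "0 \<le> (v - r *\<^sub>R w) \<bullet> (A *v (v - r *\<^sub>R w))" by (rule nn)
  also have "\<dots> = v \<bullet> (A *v v) - 2 * r * (v \<bullet> (A *v w)) + r\<^sup>2 * (w \<bullet> (A *v w))"
    using sym[of w v]
    by (simp add: matrix_vector_mult_diff_distrib matrix_vector_mult_scaleR inner_diff_left inner_diff_right
        power2_eq_square algebra_simps)
  finally have "2 * (v \<bullet> (A *v w)) * r \<le> v \<bullet> (A *v v) + r\<^sup>2 * (w \<bullet> (A *v w))" by (simp add: mult_ac)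
  then have "2 * (v \<bullet> (A *v w)) \<le> (v \<bullet> (A *v v) + r\<^sup>2 * (w \<bullet> (A *v w))) / r"
    using r by (simp add: pos_le_divide_eq)
  also have "\<dots> = 1 / r * (v \<bullet> (A *v v)) + r * (w \<bullet> (A *v w))"
    using r by (simp add: add_divide_distrib power2_eq_square)
  finally show ?thesis
    using sym[of w v]
    by (simp add: matrix_vector_right_distrib inner_add_left inner_add_right distrib_right)
qed

lemma DERIV_max_0_square: "((\<lambda>u. (max 0 u)\<^sup>2) has_real_derivative (2 * max 0 u)) (at u)"
proof -
  consider "u < 0" | "0 < u" | "u = 0" by linarith
  then show ?thesis
  proof cases
    case 1
    have "((\<lambda>u::real. 0) has_real_derivative 0) (at u)" by simp
    then have "((\<lambda>u. (max 0 u)\<^sup>2) has_real_derivative 0) (at u)"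
      by (rule has_field_derivative_transform_within_open[where S="{..<0}"]) (use 1 in auto)
    then show ?thesis using 1 by simp
  next
    case 2
    have "((\<lambda>u::real. u\<^sup>2) has_real_derivative 2 * u) (at u)" by (auto intro!: derivative_eq_intros)
    then have "((\<lambda>u. (max 0 u)\<^sup>2) has_real_derivative 2 * u) (at u)"
      by (rule has_field_derivative_transform_within_open[where S="{0<..}"]) (use 2 in auto)
    then show ?thesis using 2 by simp
  next
    case 3
    have "((\<lambda>h::real. (max 0 h)\<^sup>2 / h) \<longlongrightarrow> 0) (at 0)"
    proof (rule Lim_null_comparison)
      show "\<forall>\<^sub>F h in at 0. norm ((max 0 h)\<^sup>2 / h) \<le> \<bar>h::real\<bar>"
        by (rule always_eventually) (auto simp: max_def power2_eq_square)
      show "(abs \<longlongrightarrow> 0) (at (0::real))" using tendsto_rabs[OF tendsto_ident_at[of "0::real" UNIV]] by simp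
    qed
    then show ?thesis using 3 by (simp add: DERIV_def)
  qed
qed

text \<open>The square makes the truncated paraboloid continuously differentiable.\<close>

definition cutoff :: "real \<Rightarrow> 'a::real_inner \<Rightarrow> real"
  where "cutoff R x = (max 0 (1 - (norm x)\<^sup>2 / R\<^sup>2))\<^sup>2"

definition cutoff_grad :: "real \<Rightarrow> 'a::real_inner \<Rightarrow> 'a"
  where "cutoff_grad R x = (- (4 / R\<^sup>2) * max 0 (1 - (norm x)\<^sup>2 / R\<^sup>2)) *\<^sub>R x"

lemma gderiv_cutoff: "GDERIV (cutoff R) x :> cutoff_grad R x"
proof -
  have "((\<lambda>x. 1 - c * (x \<bullet> x)) has_derivative (\<lambda>h. - (c * (2 * (h \<bullet> x))))) (at x)" for c
    by (auto intro!: derivative_eq_intros simp: inner_commute)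
  from this[of "1 / R\<^sup>2"]
  have "((\<lambda>x. 1 - (x \<bullet> x) / R\<^sup>2) has_derivative (\<lambda>h. - (2 * (h \<bullet> x) / R\<^sup>2))) (at x)" by simp
  then have "GDERIV (\<lambda>x. 1 - (x \<bullet> x) / R\<^sup>2) x :> (- 2 / R\<^sup>2) *\<^sub>R x"
    unfolding gderiv_def by (rule has_derivative_eq_rhs) (auto simp: fun_eq_iff)
  from GDERIV_DERIV_compose[OF this DERIV_max_0_square]
  have "GDERIV (\<lambda>x. (max 0 (1 - (x \<bullet> x) / R\<^sup>2))\<^sup>2) x :>
      (2 * max 0 (1 - (x \<bullet> x) / R\<^sup>2)) *\<^sub>R (- 2 / R\<^sup>2) *\<^sub>R x" .
  moreover have "(\<lambda>x::'a. (max 0 (1 - (x \<bullet> x) / R\<^sup>2))\<^sup>2) = cutoff R"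
    by (simp add: fun_eq_iff cutoff_def power2_norm_eq_inner)
  moreover have "(2 * max 0 (1 - (x \<bullet> x) / R\<^sup>2)) *\<^sub>R (- 2 / R\<^sup>2) *\<^sub>R x = cutoff_grad R x"
    by (simp add: cutoff_grad_def power2_norm_eq_inner)
  ultimately show ?thesis by (simp only:)
qed

lemma cutoff_bounds: "0 \<le> cutoff R x" "cutoff R x \<le> 1"
proof -
  show "0 \<le> cutoff R x" by (simp add: cutoff_def)
  show "cutoff R x \<le> 1" unfolding cutoff_def by (rule power_le_one) auto
qed

lemma cutoff_outside:
  assumes "0 < R" "R < norm x"
  shows "cutoff R x = 0" "cutoff_grad R x = 0"
proof -
  have "R\<^sup>2 < (norm x)\<^sup>2" using assms by (intro power_strict_mono) auto
  then have "max 0 (1 - (norm x)\<^sup>2 / R\<^sup>2) = 0" using assms by (simp add: field_simps)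
  then show "cutoff R x = 0" "cutoff_grad R x = 0" by (simp_all add: cutoff_def cutoff_grad_def)
qed

lemma norm_cutoff_grad_le:
  assumes "0 < R"
  shows "norm (cutoff_grad R x) \<le> 4 / R"
proof (cases "R < norm x")
  case True
  then show ?thesis using cutoff_outside(2)[OF assms True] assms by simp
next
  case False
  have "norm (cutoff_grad R x) = 4 / R\<^sup>2 * max 0 (1 - (norm x)\<^sup>2 / R\<^sup>2) * norm x"
    by (simp add: cutoff_grad_def abs_mult)
  also have "\<dots> \<le> 4 / R\<^sup>2 * 1 * R"
    using False assms by (intro mult_mono) auto
  finally show ?thesis using assms by (simp add: power2_eq_square)
qed

lemma continuous_on_cutoff_grad: "continuous_on S (cutoff_grad R)"
proof -
  have "continuous_on S (\<lambda>x. (d * max 0 (1 - (norm x)\<^sup>2 * c)) *\<^sub>R x)" for c d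
    by (intro continuous_intros)
  then show ?thesis unfolding cutoff_grad_def divide_inverse .
qed

lemma tendsto_cutoff: "(\<lambda>n. cutoff (real (Suc n)) x) \<longlonglongrightarrow> 1"
proof -
  have "(\<lambda>n. (norm x)\<^sup>2 * (inverse (real (Suc n)))\<^sup>2) \<longlonglongrightarrow> (norm x)\<^sup>2 * 0\<^sup>2"
    by (intro tendsto_intros LIMSEQ_inverse_real_of_nat)
  then have "(\<lambda>n. (norm x)\<^sup>2 / (real (Suc n))\<^sup>2) \<longlonglongrightarrow> 0"
    by (simp add: divide_inverse power_inverse)
  then have "(\<lambda>n. (max 0 (1 - (norm x)\<^sup>2 / (real (Suc n))\<^sup>2))\<^sup>2) \<longlonglongrightarrow> (max 0 (1 - 0))\<^sup>2"
    by (intro tendsto_intros)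
  then show ?thesis by (simp add: cutoff_def)
qed

text \<open>The compactly supported case is applied to \<open>f\<close> times a cutoff. The gradient
  of the cutoff contributes at most a constant times (1 + R) / R^2 times the second moment of
  \<open>f\<close>, which vanishes as R grows; the other integrals converge by dominated
  convergence.\<close>

theorem brascamp_lieb:
  fixes U f :: "real^'n \<Rightarrow> real" and a b :: "real^'n \<Rightarrow> real^'n"
  assumes U: "twice_continuously_differentiable U" and prob: "prob_space (gibbs U)"
    and \<kappa>: "0 < \<kappa>" "\<And>z w. \<kappa> * (norm w)\<^sup>2 \<le> U (z + w) + U (z - w) - 2 * U z"
    and f: "\<And>x. GDERIV f x :> a x" and a: "continuous_on UNIV a"
    and b: "\<And>x. hessian U x *v b x = a x"
    and int: "integrable (gibbs U) (\<lambda>x. (f x)\<^sup>2)" "integrable (gibbs U) (\<lambda>x. a x \<bullet> b x)"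
  shows "(\<integral>x. (f x)\<^sup>2 \<partial>gibbs U) - (\<integral>x. f x \<partial>gibbs U)\<^sup>2 \<le> (\<integral>x. a x \<bullet> b x \<partial>gibbs U)"
proof -
  interpret prob_space "gibbs U" by (rule prob)
  note lower = hessian_lower_bound[OF U \<kappa>(2)]
  note sym = hessian_symmetric[OF U]
  have Hnn: "0 \<le> v \<bullet> (hessian U x *v v)" for v x
    using lower[of v x] \<kappa>(1) by (meson less_imp_le mult_nonneg_nonneg order_trans zero_le_power2)
  have b_cont: "continuous_on UNIV b"
    by (rule hessian_solution_continuous[OF U \<kappa>(1) lower a b])
  have f_cont: "continuous_on UNIV f" by (rule gderiv_imp_continuous_on[OF f])
  have [measurable]: "f \<in> borel_measurable borel" "a \<in> borel_measurable borel" "b \<in> borel_measurable borel"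
    by (intro borel_measurable_continuous_onI f_cont a b_cont)+
  have int_f: "integrable (gibbs U) f"
  proof (rule Bochner_Integration.integrable_bound)
    show "integrable (gibbs U) (\<lambda>x. 1 + (f x)\<^sup>2)" using int(1) by simp
    have "\<bar>u\<bar> \<le> 1 + u\<^sup>2" for u :: real
    proof -
      have "2 * \<bar>u\<bar> \<le> 1 + u\<^sup>2" using zero_le_power2[of "\<bar>u\<bar> - 1"] by (simp add: power2_diff)
      then show ?thesis by simp
    qed
    then have "norm (f x) \<le> norm (1 + (f x)\<^sup>2)" for x
      unfolding real_norm_def by (rule order_trans[OF _ abs_ge_self])
    then show "AE x in gibbs U. norm (f x) \<le> norm (1 + (f x)\<^sup>2)" by simp
  qed measurable
  let ?R = "\<lambda>n. real (Suc n)"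
  have cut_meas[measurable]: "cutoff R \<in> borel_measurable borel" for R :: real
    by (intro borel_measurable_continuous_onI gderiv_imp_continuous_on[OF gderiv_cutoff])
  have step: "(\<integral>x. (f x * cutoff (?R n) x)\<^sup>2 \<partial>gibbs U) - (\<integral>x. f x * cutoff (?R n) x \<partial>gibbs U)\<^sup>2
      \<le> (1 + 1 / ?R n) * (\<integral>x. a x \<bullet> b x \<partial>gibbs U)
        + (1 + ?R n) * (16 / (?R n)\<^sup>2 / \<kappa>) * (\<integral>x. (f x)\<^sup>2 \<partial>gibbs U)" for n
  proof -
    define R where "R = ?R n"
    have R: "0 < R" by (simp add: R_def)
    define c where "c x = matrix_inv (hessian U x) *v cutoff_grad R x" for x
    have c: "hessian U x *v c x = cutoff_grad R x" for x
      unfolding c_def by (rule positive_definite_matrix_inv[OF \<kappa>(1) lower])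
    have c_cont: "continuous_on UNIV c"
      by (rule hessian_solution_continuous[OF U \<kappa>(1) lower continuous_on_cutoff_grad c])
    define A where "A x = f x *\<^sub>R cutoff_grad R x + cutoff R x *\<^sub>R a x" for x
    define B where "B x = f x *\<^sub>R c x + cutoff R x *\<^sub>R b x" for x
    have HB: "hessian U x *v B x = A x" for x
      by (simp add: A_def B_def matrix_vector_right_distrib matrix_vector_mult_scaleR b c)
    have AB_cont: "continuous_on UNIV A" "continuous_on UNIV B"
      unfolding A_def[abs_def] B_def[abs_def]
      by (intro continuous_intros f_cont a b_cont c_cont continuous_on_cutoff_grad
          gderiv_imp_continuous_on[OF gderiv_cutoff])+
    have [measurable]: "A \<in> borel_measurable borel" "B \<in> borel_measurable borel"
      by (intro borel_measurable_continuous_onI AB_cont)+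
    have bound: "A x \<bullet> B x \<le> (1 + 1 / R) * (a x \<bullet> b x) + (1 + R) * (16 / R\<^sup>2 / \<kappa>) * (f x)\<^sup>2" for x
    proof -
      \<comment> \<open>The inverse Hessian has norm at most 1 / \<kappa> and the cutoff gradient at
        most 4 / R, whence the constant 16 / (R^2 \<kappa>).\<close>
      have "\<kappa> * norm (c x) \<le> 4 / R"
        using matrix_vector_mult_norm_lower_bound[OF lower, of "c x" x] norm_cutoff_grad_le[OF R, of x]
        unfolding c by linarith
      then have nc: "norm (c x) \<le> 4 / R / \<kappa>" using \<kappa>(1) by (simp only: pos_le_divide_eq mult.commute)
      have "c x \<bullet> (hessian U x *v c x) \<le> norm (c x) * norm (cutoff_grad R x)"
        unfolding c by (rule norm_cauchy_schwarz)
      also have "\<dots> \<le> (4 / R / \<kappa>) * (4 / R)"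
        using nc norm_cutoff_grad_le[OF R, of x] R \<kappa>(1) by (intro mult_mono) auto
      also have "\<dots> = 16 / R\<^sup>2 / \<kappa>" by (simp add: power2_eq_square)
      finally have cc: "c x \<bullet> (hessian U x *v c x) \<le> 16 / R\<^sup>2 / \<kappa>" .
      have "A x \<bullet> B x = (cutoff R x *\<^sub>R b x + f x *\<^sub>R c x) \<bullet> (hessian U x *v (cutoff R x *\<^sub>R b x + f x *\<^sub>R c x))"
        by (subst HB[symmetric]) (simp add: B_def inner_commute add.commute)
      also have "\<dots> \<le> (1 + 1 / R) * ((cutoff R x *\<^sub>R b x) \<bullet> (hessian U x *v (cutoff R x *\<^sub>R b x)))
          + (1 + R) * ((f x *\<^sub>R c x) \<bullet> (hessian U x *v (f x *\<^sub>R c x)))"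
        by (rule quadratic_form_add_le[OF sym Hnn R])
      finally have AB: "A x \<bullet> B x \<le> \<dots>" .
      have "(cutoff R x *\<^sub>R b x) \<bullet> (hessian U x *v (cutoff R x *\<^sub>R b x)) = (cutoff R x)\<^sup>2 * (a x \<bullet> b x)"
        by (simp add: matrix_vector_mult_scaleR b power2_eq_square inner_commute)
      also have "\<dots> \<le> 1 * (a x \<bullet> b x)"
        using cutoff_bounds[of R x] Hnn[of "b x" x]
        by (intro mult_right_mono power_le_one) (auto simp: b inner_commute)
      finally have b_part: "(cutoff R x *\<^sub>R b x) \<bullet> (hessian U x *v (cutoff R x *\<^sub>R b x)) \<le> a x \<bullet> b x"
        by simp
      have "(f x *\<^sub>R c x) \<bullet> (hessian U x *v (f x *\<^sub>R c x)) = (f x)\<^sup>2 * (c x \<bullet> (hessian U x *v c x))"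
        by (simp add: matrix_vector_mult_scaleR power2_eq_square)
      also have "\<dots> \<le> (f x)\<^sup>2 * (16 / R\<^sup>2 / \<kappa>)" using cc by (intro mult_left_mono) auto
      finally have c_part: "(f x *\<^sub>R c x) \<bullet> (hessian U x *v (f x *\<^sub>R c x)) \<le> 16 / R\<^sup>2 / \<kappa> * (f x)\<^sup>2"
        by (simp only: mult.commute)
      show ?thesis
        unfolding mult.assoc using R
        by (intro order_trans[OF AB] add_mono mult_left_mono b_part c_part) auto
    qed
    have ABnn: "0 \<le> A x \<bullet> B x" for x
      using Hnn[of "B x" x] by (simp add: HB inner_commute)
    have int_dom: "integrable (gibbs U) (\<lambda>x. (1 + 1 / R) * (a x \<bullet> b x) + (1 + R) * (16 / R\<^sup>2 / \<kappa>) * (f x)\<^sup>2)"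
      using int by (intro Bochner_Integration.integrable_add integrable_mult_right)
    have int_AB: "integrable (gibbs U) (\<lambda>x. A x \<bullet> B x)"
      by (rule Bochner_Integration.integrable_bound[OF int_dom])
         (use ABnn bound order_trans[OF ABnn bound] in auto)
    have "(\<integral>x. (f x * cutoff R x)\<^sup>2 \<partial>gibbs U) - (\<integral>x. f x * cutoff R x \<partial>gibbs U)\<^sup>2 \<le> (\<integral>x. A x \<bullet> B x \<partial>gibbs U)"
    proof (rule brascamp_lieb_compact_support[OF U prob \<kappa>, where R=R])
      show "GDERIV (\<lambda>x. f x * cutoff R x) x :> A x" for x
        unfolding A_def by (rule gderiv_mult[OF f gderiv_cutoff])
      show "R < norm x \<Longrightarrow> f x * cutoff R x = 0" "R < norm x \<Longrightarrow> A x = 0" for x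
        by (simp_all add: A_def cutoff_outside[OF R])
    qed (rule AB_cont HB)+
    also have "\<dots> \<le> (\<integral>x. (1 + 1 / R) * (a x \<bullet> b x) + (1 + R) * (16 / R\<^sup>2 / \<kappa>) * (f x)\<^sup>2 \<partial>gibbs U)"
      by (rule integral_mono[OF int_AB int_dom bound])
    also have "\<dots> = (1 + 1 / R) * (\<integral>x. a x \<bullet> b x \<partial>gibbs U)
        + (1 + R) * (16 / R\<^sup>2 / \<kappa>) * (\<integral>x. (f x)\<^sup>2 \<partial>gibbs U)"
      using int by (subst Bochner_Integration.integral_add) auto
    finally show ?thesis unfolding R_def .
  qed
  have cut: "\<bar>cutoff R x\<bar> \<le> 1" for R and x :: "real^'n" using cutoff_bounds[of R x] by simp
  have L1: "(\<lambda>n. \<integral>x. (f x * cutoff (?R n) x)\<^sup>2 \<partial>gibbs U) \<longlonglongrightarrow> (\<integral>x. (f x)\<^sup>2 \<partial>gibbs U)"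
  proof (rule integral_dominated_convergence[OF _ _ int(1)])
    show "AE x in gibbs U. (\<lambda>n. (f x * cutoff (?R n) x)\<^sup>2) \<longlonglongrightarrow> (f x)\<^sup>2"
    proof (rule AE_I2)
      fix x
      have "(\<lambda>n. (f x * cutoff (?R n) x)\<^sup>2) \<longlonglongrightarrow> (f x * 1)\<^sup>2"
        by (intro tendsto_intros tendsto_cutoff)
      then show "(\<lambda>n. (f x * cutoff (?R n) x)\<^sup>2) \<longlonglongrightarrow> (f x)\<^sup>2" by simp
    qed
    show "AE x in gibbs U. norm ((f x * cutoff (?R n) x)\<^sup>2) \<le> (f x)\<^sup>2" for n
    proof (rule AE_I2)
      fix x
      have "(f x)\<^sup>2 * (cutoff (?R n) x)\<^sup>2 \<le> (f x)\<^sup>2 * 1"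
        using cutoff_bounds[of "?R n" x] by (intro mult_left_mono power_le_one) auto
      then show "norm ((f x * cutoff (?R n) x)\<^sup>2) \<le> (f x)\<^sup>2" by (simp add: power_mult_distrib)
    qed
  qed measurable
  have L2: "(\<lambda>n. \<integral>x. f x * cutoff (?R n) x \<partial>gibbs U) \<longlonglongrightarrow> (\<integral>x. f x \<partial>gibbs U)"
  proof (rule integral_dominated_convergence[where w="\<lambda>x. \<bar>f x\<bar>"])
    show "AE x in gibbs U. (\<lambda>n. f x * cutoff (?R n) x) \<longlonglongrightarrow> f x"
    proof (rule AE_I2)
      fix x
      have "(\<lambda>n. f x * cutoff (?R n) x) \<longlonglongrightarrow> f x * 1"
        by (intro tendsto_intros tendsto_cutoff)
      then show "(\<lambda>n. f x * cutoff (?R n) x) \<longlonglongrightarrow> f x" by simp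
    qed
    show "AE x in gibbs U. norm (f x * cutoff (?R n) x) \<le> \<bar>f x\<bar>" for n
      using cut by (auto simp: abs_mult intro!: mult_left_le)
  qed (use int_f in \<open>auto intro: integrable_abs\<close>)
  have inv0: "(\<lambda>n. 1 / ?R n) \<longlonglongrightarrow> 0" using LIMSEQ_inverse_real_of_nat by (simp add: inverse_eq_divide)
  have L3: "(\<lambda>n. (1 + 1 / ?R n) * (\<integral>x. a x \<bullet> b x \<partial>gibbs U)
        + (1 / ?R n * (1 / ?R n) + 1 / ?R n) * (16 / \<kappa>) * (\<integral>x. (f x)\<^sup>2 \<partial>gibbs U))
      \<longlonglongrightarrow> (1 + 0) * (\<integral>x. a x \<bullet> b x \<partial>gibbs U) + (0 * 0 + 0) * (16 / \<kappa>) * (\<integral>x. (f x)\<^sup>2 \<partial>gibbs U)"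
    by (intro tendsto_intros inv0)
  \<comment> \<open>The factor (1 + R) / R^2 is rewritten as a polynomial in 1 / R, whose limit is
    immediate.\<close>
  have "(1 + ?R n) * (16 / (?R n)\<^sup>2 / \<kappa>) = (1 / ?R n * (1 / ?R n) + 1 / ?R n) * (16 / \<kappa>)" for n
  proof -
    have *: "(1 + R) * (16 / R\<^sup>2 / \<kappa>) = (1 / R * (1 / R) + 1 / R) * (16 / \<kappa>)" if "R \<noteq> 0" for R :: real
      using that \<kappa>(1) by (simp add: field_simps power2_eq_square)
    show ?thesis by (rule *) simp
  qed
  then have L3': "(\<lambda>n. (1 + 1 / ?R n) * (\<integral>x. a x \<bullet> b x \<partial>gibbs U)
        + (1 + ?R n) * (16 / (?R n)\<^sup>2 / \<kappa>) * (\<integral>x. (f x)\<^sup>2 \<partial>gibbs U))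
      \<longlonglongrightarrow> (\<integral>x. a x \<bullet> b x \<partial>gibbs U)"
    using L3 by (simp only: mult_zero_left add_0_left add_0_right mult_1_left)
  show ?thesis
    by (rule LIMSEQ_le[OF tendsto_diff[OF L1 tendsto_power[OF L2, of 2]] L3']) (use step in blast)
qed

section \<open>Tilted potentials\<close>

lemma gderiv_norm_square: "GDERIV (\<lambda>x. (norm x)\<^sup>2) x :> 2 *\<^sub>R x"
  unfolding gderiv_def power2_norm_eq_inner
  by (auto intro!: derivative_eq_intros simp: inner_commute)

lemma grad_tilted:
  assumes V: "twice_continuously_differentiable V"
  shows "GDERIV (tilted V \<beta>) x :> grad V x + (2 * \<beta>) *\<^sub>R x"
proof -
  have "GDERIV (\<lambda>x. \<beta> * (norm x)\<^sup>2) x :> \<beta> *\<^sub>R 2 *\<^sub>R x + (norm x)\<^sup>2 *\<^sub>R 0"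
    by (intro gderiv_mult GDERIV_const gderiv_norm_square)
  from GDERIV_add[OF GDERIV_add[OF tcd_gderiv[OF V] this] GDERIV_const]
  have "GDERIV (tilted V \<beta>) x :> grad V x + (\<beta> *\<^sub>R 2 *\<^sub>R x + (norm x)\<^sup>2 *\<^sub>R 0) + 0"
    unfolding tilted_def .
  then show ?thesis by (simp add: mult.commute)
qed

lemma twice_continuously_differentiable_tilted:
  fixes V :: "real^'n \<Rightarrow> real"
  assumes V: "twice_continuously_differentiable V"
  shows "twice_continuously_differentiable (tilted V \<beta>)"
proof -
  have g: "grad (tilted V \<beta>) = (\<lambda>x. grad V x + (2 * \<beta>) *\<^sub>R x)"
    using grad_eqI[OF grad_tilted[OF V]] by (rule ext)
  have "(grad (tilted V \<beta>) has_derivative (\<lambda>h. hessian V x *v h + (2 * \<beta>) *\<^sub>R h)) (at x)" for x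
    unfolding g by (intro has_derivative_add tcd_grad_derivative[OF V]) (auto intro!: derivative_eq_intros)
  moreover have "(\<lambda>h. hessian V x *v h + (2 * \<beta>) *\<^sub>R h) = (\<lambda>h. (hessian V x + (2 * \<beta>) *\<^sub>R mat 1) *v h)" for x
    by (simp add: fun_eq_iff matrix_vector_mult_add_rdistrib scaleR_matrix_vector_assoc[symmetric])
  ultimately have d: "(grad (tilted V \<beta>) has_derivative (\<lambda>h. (hessian V x + (2 * \<beta>) *\<^sub>R mat 1) *v h)) (at x)" for x
    by simp
  have "hessian (tilted V \<beta>) = (\<lambda>x. hessian V x + (2 * \<beta>) *\<^sub>R mat 1)"
  proof
    fix x
    show "hessian (tilted V \<beta>) x = hessian V x + (2 * \<beta>) *\<^sub>R mat 1"
      unfolding hessian_def[of "tilted V \<beta>"] jacobian_def frechet_derivative_at[OF d, symmetric]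
      by (rule matrix_of_matrix_vector_mul)
  qed
  then have "continuous_on UNIV (hessian (tilted V \<beta>))"
    by (auto intro!: continuous_intros tcd_hessian_continuous[OF V])
  moreover have "tilted V \<beta> differentiable (at x)" for x
    using grad_tilted[OF V, of \<beta> x] unfolding gderiv_def by (rule differentiableI)
  moreover have "grad (tilted V \<beta>) differentiable (at x)" for x
    using d by (rule differentiableI)
  ultimately show ?thesis by (simp add: twice_continuously_differentiable_def)
qed

text \<open>Midpoint convexity of \<open>V\<close> plus the parallelogram identity for the quadratic
  part; the normalizing constant cancels in the second difference.\<close>

lemma tilted_strongly_convex:
  assumes "convex_on UNIV V"
  shows "2 * \<beta> * (norm w)\<^sup>2 \<le> tilted V \<beta> (z + w) + tilted V \<beta> (z - w) - 2 * tilted V \<beta> z"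
proof -
  have "(1 - 1/2) *\<^sub>R (z + w) + (1/2) *\<^sub>R (z - w) = (1/2) *\<^sub>R (z + z)"
    unfolding scaleR_add_right scaleR_diff_right by simp
  also have "\<dots> = z" by (simp add: scaleR_2[symmetric])
  finally have "V z \<le> (1 - 1/2) * V (z + w) + 1/2 * V (z - w)"
    using convex_onD[OF assms, of "1/2" "z + w" "z - w"] by simp
  then have "2 * V z \<le> V (z + w) + V (z - w)" by simp
  moreover have "(norm (z + w))\<^sup>2 + (norm (z - w))\<^sup>2 = 2 * (norm z)\<^sup>2 + 2 * (norm w)\<^sup>2"
    by (simp add: power2_norm_eq_inner inner_add_left inner_add_right inner_diff_left inner_diff_right)
  then have "\<beta> * (norm (z + w))\<^sup>2 + \<beta> * (norm (z - w))\<^sup>2 = 2 * \<beta> * (norm z)\<^sup>2 + 2 * \<beta> * (norm w)\<^sup>2"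
    by (metis (no_types) distrib_left mult.assoc mult.commute)
  ultimately show ?thesis unfolding tilted_def by simp
qed

section \<open>Normalization and bias of the tilted measure\<close>

lemma measure_gibbs_eq:
  assumes [measurable]: "W \<in> borel_measurable borel" "A \<in> sets borel"
    and "prob_space (gibbs W)"
  shows "measure (gibbs W) A = (\<integral>x. exp (- W x) * indicator A x \<partial>lborel)"
proof -
  interpret prob_space "gibbs W" by fact
  have "measure (gibbs W) A = (\<integral>x. indicator A x \<partial>gibbs W)" by simp
  also have "\<dots> = (\<integral>x. exp (- W x) * indicator A x \<partial>lborel)" by (rule integral_gibbs) auto
  finally show ?thesis .
qed

context
  fixes V :: "'a::euclidean_space \<Rightarrow> real" and \<beta> :: real
  assumes V_meas[measurable]: "V \<in> borel_measurable borel"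
    and prob_V: "prob_space (gibbs V)" and \<beta>: "0 < \<beta>"
begin

definition "partition_fun = (\<integral>y. exp (- V y - \<beta> * (norm y)\<^sup>2) \<partial>lborel)"

lemma integrable_exp_potential: "integrable lborel (\<lambda>x. exp (- V x))"
  and integral_exp_potential: "(\<integral>x. exp (- V x) \<partial>lborel) = 1"
proof -
  have "emeasure (gibbs V) UNIV = 1"
    using prob_space.emeasure_space_1[OF prob_V] by simp
  then have *: "(\<integral>\<^sup>+x. ennreal (exp (- V x)) \<partial>lborel) = ennreal 1"
    unfolding gibbs_def by (simp add: emeasure_density)
  show "integrable lborel (\<lambda>x. exp (- V x))" "(\<integral>x. exp (- V x) \<partial>lborel) = 1"
    using nn_integral_eq_integrable[of "\<lambda>x. exp (- V x)" lborel 1] * by auto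
qed

lemma integrable_exp_tilted: "integrable lborel (\<lambda>x. exp (- V x - \<beta> * (norm x)\<^sup>2))"
  by (rule Bochner_Integration.integrable_bound[OF integrable_exp_potential]) (use \<beta> in auto)

text \<open>Positivity is what makes the \<open>ln\<close> in \<open>tilted\<close> a genuine
  normalization. The integral cannot vanish because its integrand vanishes nowhere.\<close>

lemma partition_fun_pos: "0 < partition_fun"
proof -
  have "0 \<le> partition_fun" unfolding partition_fun_def by (intro integral_nonneg_AE) auto
  moreover have "partition_fun \<noteq> 0"
  proof
    assume "partition_fun = 0"
    then have "AE x in lborel. exp (- V x - \<beta> * (norm x)\<^sup>2) = 0"
      unfolding partition_fun_def
      by (subst (asm) integral_nonneg_eq_0_iff_AE[OF integrable_exp_tilted]) auto
    then have "AE x in (lborel :: 'a measure). False" by simp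
    then show False by (simp add: AE_iff_measurable[of UNIV])
  qed
  ultimately show ?thesis by simp
qed

lemma partition_fun_le_1: "partition_fun \<le> 1"
  unfolding partition_fun_def integral_exp_potential[symmetric]
  using \<beta> by (intro integral_mono integrable_exp_tilted integrable_exp_potential) auto

lemma exp_minus_tilted: "exp (- tilted V \<beta> x) = exp (- V x - \<beta> * (norm x)\<^sup>2) / partition_fun"
  using partition_fun_pos
  by (simp add: tilted_def partition_fun_def[symmetric] exp_diff[of _ "ln _", simplified] exp_minus exp_add divide_inverse)

lemma tilted_measurable: "tilted V \<beta> \<in> borel_measurable borel"
  unfolding tilted_def by measurable

lemma integrable_exp_minus_tilted: "integrable lborel (\<lambda>x. exp (- tilted V \<beta> x))"
  unfolding exp_minus_tilted using integrable_exp_tilted by simp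

lemma prob_space_gibbs_tilted: "prob_space (gibbs (tilted V \<beta>))"
proof (rule prob_spaceI)
  have "(\<integral>x. exp (- tilted V \<beta> x) \<partial>lborel) = 1"
    unfolding exp_minus_tilted using partition_fun_pos by (simp add: partition_fun_def[symmetric])
  then have "(\<integral>\<^sup>+x. ennreal (exp (- tilted V \<beta> x)) \<partial>lborel) = 1"
    by (subst nn_integral_eq_integral[OF integrable_exp_minus_tilted]) auto
  then show "emeasure (gibbs (tilted V \<beta>)) (space (gibbs (tilted V \<beta>))) = 1"
    unfolding gibbs_def using tilted_measurable by (simp add: emeasure_density)
qed

text \<open>Dividing by a partition function of at most 1 only raises the tilted density, so by 1 -
  s \<le> exp (- s) the original density exceeds it by at most \<beta> |x|^2 exp (- V x). This is
  one-sided; the other side is the same bound for the complement, both measures having mass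
  1.\<close>

lemma gibbs_tilted_tv:
  assumes int: "integrable (gibbs V) (\<lambda>x. (norm x)\<^sup>2)" and A: "A \<in> sets borel"
  shows "\<bar>measure (gibbs (tilted V \<beta>)) A - measure (gibbs V) A\<bar> \<le> \<beta> * (\<integral>x. (norm x)\<^sup>2 \<partial>gibbs V)"
proof -
  interpret V: prob_space "gibbs V" by (rule prob_V)
  interpret T: prob_space "gibbs (tilted V \<beta>)" by (rule prob_space_gibbs_tilted)
  note [measurable] = tilted_measurable
  have int': "integrable lborel (\<lambda>x. exp (- V x) * (norm x)\<^sup>2)"
    using int by (subst (asm) integrable_gibbs_iff) auto
  have low: "measure (gibbs V) S - measure (gibbs (tilted V \<beta>)) S \<le> \<beta> * (\<integral>x. (norm x)\<^sup>2 \<partial>gibbs V)"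
    if [measurable]: "S \<in> sets borel" for S
  proof -
    have i1: "integrable lborel (\<lambda>x. exp (- V x) * indicator S x)"
      by (rule Bochner_Integration.integrable_bound[OF integrable_exp_potential]) (auto simp: indicator_def)
    have i2: "integrable lborel (\<lambda>x. exp (- tilted V \<beta> x) * indicator S x)"
      by (rule Bochner_Integration.integrable_bound[OF integrable_exp_minus_tilted]) (auto simp: indicator_def)
    have "measure (gibbs V) S - measure (gibbs (tilted V \<beta>)) S
        = (\<integral>x. exp (- V x) * indicator S x - exp (- tilted V \<beta> x) * indicator S x \<partial>lborel)"
      by (subst (1 2) measure_gibbs_eq) (use i1 i2 prob_V prob_space_gibbs_tilted in auto)
    also have "\<dots> \<le> (\<integral>x. \<beta> * (exp (- V x) * (norm x)\<^sup>2) \<partial>lborel)"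
    proof (rule integral_mono)
      fix x
      have "exp (- V x) * (1 - \<beta> * (norm x)\<^sup>2) \<le> exp (- V x) * exp (- \<beta> * (norm x)\<^sup>2)"
        using exp_ge_add_one_self[of "- \<beta> * (norm x)\<^sup>2"] by (intro mult_left_mono) auto
      also have "\<dots> \<le> exp (- tilted V \<beta> x)"
        unfolding exp_minus_tilted using partition_fun_pos partition_fun_le_1
        by (simp add: exp_add[symmetric] pos_le_divide_eq mult_le_cancel_left1)
      finally have "exp (- V x) - exp (- tilted V \<beta> x) \<le> \<beta> * (exp (- V x) * (norm x)\<^sup>2)"
        by (simp add: algebra_simps)
      moreover have "0 \<le> \<beta> * (exp (- V x) * (norm x)\<^sup>2)" using \<beta> by simp
      ultimately show "exp (- V x) * indicator S x - exp (- tilted V \<beta> x) * indicator S x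
          \<le> \<beta> * (exp (- V x) * (norm x)\<^sup>2)"
        by (cases "x \<in> S") auto
    qed (use i1 i2 int' in auto)
    also have "\<dots> = \<beta> * (\<integral>x. (norm x)\<^sup>2 \<partial>gibbs V)"
      by (subst integral_gibbs) auto
    finally show ?thesis .
  qed
  have "measure (gibbs V) (UNIV - A) = 1 - measure (gibbs V) A"
    "measure (gibbs (tilted V \<beta>)) (UNIV - A) = 1 - measure (gibbs (tilted V \<beta>)) A"
    using V.prob_compl[of A] T.prob_compl[of A] A by auto
  then show ?thesis using low[of A] low[of "UNIV - A"] A by auto
qed

end

section \<open>Decay of the chi-square divergence\<close>

text \<open>Used in place of Cauchy-Schwarz to avoid square roots: after integration,
  \<open>k\<close> equal to the root of the chi-square divergence would give the usual bound by half
  that root. The value used in the end is \<epsilon>.\<close>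

lemma half_abs_le: "0 < k \<Longrightarrow> \<bar>u\<bar> / 2 \<le> (u\<^sup>2 / k + k) / 4" for u k :: real
proof -
  assume k: "0 < k"
  have "(\<bar>u\<bar> - k)\<^sup>2 = u\<^sup>2 - 2 * \<bar>u\<bar> * k + k\<^sup>2" by (simp add: power2_diff)
  then have "2 * \<bar>u\<bar> * k \<le> u\<^sup>2 + k\<^sup>2" using zero_le_power2[of "\<bar>u\<bar> - k"] by linarith
  then have "2 * \<bar>u\<bar> \<le> (u\<^sup>2 + k\<^sup>2) / k" using k by (simp add: pos_le_divide_eq)
  also have "\<dots> = u\<^sup>2 / k + k" using k by (simp add: add_divide_distrib power2_eq_square)
  finally show ?thesis by simp
qed

context
  fixes U :: "'a::euclidean_space \<Rightarrow> real" and r :: "'a \<Rightarrow> real"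
  assumes U_meas[measurable]: "U \<in> borel_measurable borel" and prob_U: "prob_space (gibbs U)"
    and r_meas[measurable]: "r \<in> borel_measurable borel" and r_nonneg: "\<And>x. 0 \<le> r x"
    and prob_r: "prob_space (density lborel (\<lambda>x. ennreal (r x)))"
    and int_sq: "integrable lborel (\<lambda>x. (r x)\<^sup>2 / exp (- U x))"
begin

lemma integrable_prob_density: "integrable lborel r"
  and integral_prob_density: "(\<integral>x. r x \<partial>lborel) = 1"
proof -
  have "emeasure (density lborel (\<lambda>x. ennreal (r x))) UNIV = 1"
    using prob_space.emeasure_space_1[OF prob_r] by simp
  then have *: "(\<integral>\<^sup>+x. ennreal (r x) \<partial>lborel) = ennreal 1"
    by (simp add: emeasure_density)
  show "integrable lborel r" "(\<integral>x. r x \<partial>lborel) = 1"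
    using nn_integral_eq_integrable[of r lborel 1] * r_nonneg by auto
qed

lemma relative_density:
  shows "integrable (gibbs U) (\<lambda>x. r x / exp (- U x))" "(\<integral>x. r x / exp (- U x) \<partial>gibbs U) = 1"
    and "integrable (gibbs U) (\<lambda>x. (r x / exp (- U x))\<^sup>2)"
      "(\<integral>x. (r x / exp (- U x))\<^sup>2 \<partial>gibbs U) = (\<integral>x. (r x)\<^sup>2 / exp (- U x) \<partial>lborel)"
proof -
  have e1: "exp (- U x) * (r x / exp (- U x)) = r x" for x by simp
  have e2: "exp (- U x) * (r x / exp (- U x))\<^sup>2 = (r x)\<^sup>2 / exp (- U x)" for x
    by (simp add: power2_eq_square)
  show "integrable (gibbs U) (\<lambda>x. r x / exp (- U x))"
    by (subst integrable_gibbs_iff) (measurable, simp only: e1 integrable_prob_density)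
  show "(\<integral>x. r x / exp (- U x) \<partial>gibbs U) = 1"
    by (subst integral_gibbs) (measurable, simp only: e1 integral_prob_density)
  show "integrable (gibbs U) (\<lambda>x. (r x / exp (- U x))\<^sup>2)"
    by (subst integrable_gibbs_iff) (measurable, simp only: e2 int_sq)
  show "(\<integral>x. (r x / exp (- U x))\<^sup>2 \<partial>gibbs U) = (\<integral>x. (r x)\<^sup>2 / exp (- U x) \<partial>lborel)"
    by (subst integral_gibbs) (measurable, simp only: e2)
qed

lemma chi_square_eq_variance:
  shows "integrable (gibbs U) (\<lambda>x. (r x / exp (- U x) - 1)\<^sup>2)"
    and "(\<integral>x. (r x / exp (- U x) - 1)\<^sup>2 \<partial>gibbs U) = (\<integral>x. (r x)\<^sup>2 / exp (- U x) \<partial>lborel) - 1"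
proof -
  interpret prob_space "gibbs U" by (rule prob_U)
  have sq: "(r x / exp (- U x) - 1)\<^sup>2 = (r x / exp (- U x))\<^sup>2 - 2 * (r x / exp (- U x)) + 1" for x
    by (simp add: power2_diff del: times_divide_eq_right)
  show "integrable (gibbs U) (\<lambda>x. (r x / exp (- U x) - 1)\<^sup>2)"
    unfolding sq using relative_density(1,3)
    by (intro Bochner_Integration.integrable_add Bochner_Integration.integrable_diff integrable_mult_right) auto
  have "(\<integral>x. (r x / exp (- U x) - 1)\<^sup>2 \<partial>gibbs U)
      = (\<integral>x. (r x / exp (- U x))\<^sup>2 \<partial>gibbs U) - (\<integral>x. 2 * (r x / exp (- U x)) \<partial>gibbs U) + (\<integral>x. 1 \<partial>gibbs U)"
    unfolding sq using relative_density(1,3)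
    by (simp only: Bochner_Integration.integral_add Bochner_Integration.integral_diff
        Bochner_Integration.integrable_diff integrable_mult_right integrable_const)
  also have "(\<integral>x. 2 * (r x / exp (- U x)) \<partial>gibbs U) = 2"
    unfolding integral_mult_right_zero relative_density(2) by simp
  finally show "(\<integral>x. (r x / exp (- U x) - 1)\<^sup>2 \<partial>gibbs U) = (\<integral>x. (r x)\<^sup>2 / exp (- U x) \<partial>lborel) - 1"
    using relative_density(4) prob_space by simp
qed

lemma second_moment_relative_density_ge_1: "1 \<le> (\<integral>x. (r x)\<^sup>2 / exp (- U x) \<partial>lborel)"
proof -
  have "0 \<le> (\<integral>x. (r x / exp (- U x) - 1)\<^sup>2 \<partial>gibbs U)" by (intro integral_nonneg_AE) auto
  then show ?thesis unfolding chi_square_eq_variance by simp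
qed

lemma measure_density_gibbs_diff_le:
  assumes A: "A \<in> sets borel" and k: "0 < k"
  shows "\<bar>measure (density lborel (\<lambda>x. ennreal (r x))) A - measure (gibbs U) A\<bar>
    \<le> (((\<integral>x. (r x)\<^sup>2 / exp (- U x) \<partial>lborel) - 1) / k + k) / 4"
proof -
  interpret prob_space "gibbs U" by (rule prob_U)
  note [measurable] = A
  let ?f = "\<lambda>x. r x / exp (- U x)"
  \<comment> \<open>Subtracting 1/2 from the indicator leaves the integral unchanged, since
    \<open>?f x - 1\<close> has mean 0, and makes the first factor exactly 1/2 in absolute value, a
    gain of a factor 2.\<close>
  let ?h = "\<lambda>x. (indicator A x - 1 / 2) * (?f x - 1)"
  have fA: "integrable (gibbs U) (\<lambda>x. indicator A x * ?f x)"
    by (rule Bochner_Integration.integrable_bound[OF relative_density(1)]) (auto simp: indicator_def)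
  have "measure (density lborel (\<lambda>x. ennreal (r x))) A = (\<integral>x. indicator A x * r x \<partial>lborel)"
  proof -
    have "measure (density lborel (\<lambda>x. ennreal (r x))) A = (\<integral>x. indicator A x \<partial>density lborel (\<lambda>x. ennreal (r x)))"
      by simp
    also have "\<dots> = (\<integral>x. r x * indicator A x \<partial>lborel)"
      using r_nonneg by (subst integral_density) auto
    finally show ?thesis by (simp add: mult.commute)
  qed
  also have "\<dots> = (\<integral>x. indicator A x * ?f x \<partial>gibbs U)"
  proof -
    have "exp (- U x) * (indicator A x * ?f x) = indicator A x * r x" for x by simp
    note e = this
    have "(\<lambda>x. indicator A x * ?f x) \<in> borel_measurable borel" by measurable
    from integral_gibbs[OF U_meas this] show ?thesis by (simp only: e)
  qed
  finally have 1: "measure (density lborel (\<lambda>x. ennreal (r x))) A = (\<integral>x. indicator A x * ?f x \<partial>gibbs U)" .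
  have 2: "measure (gibbs U) A = (\<integral>x. indicator A x \<partial>gibbs U)" by simp
  have h: "?h x = (indicator A x * ?f x - indicator A x) - (1 / 2 * ?f x - 1 / 2)" for x
    by (simp add: algebra_simps)
  have iA: "integrable (gibbs U) (\<lambda>x. indicator A x :: real)"
    by (rule integrable_const_bound[of _ 1]) (auto simp: indicator_def)
  have i1: "integrable (gibbs U) (\<lambda>x. indicator A x * ?f x - indicator A x)"
    by (intro Bochner_Integration.integrable_diff fA iA)
  have i2: "integrable (gibbs U) (\<lambda>x. 1 / 2 * ?f x - 1 / 2)"
    by (intro Bochner_Integration.integrable_diff integrable_mult_right relative_density(1) integrable_const)
  have "(\<integral>x. ?h x \<partial>gibbs U) = (\<integral>x. indicator A x * ?f x - indicator A x \<partial>gibbs U) - (\<integral>x. 1 / 2 * ?f x - 1 / 2 \<partial>gibbs U)"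
    unfolding h by (rule Bochner_Integration.integral_diff[OF i1 i2])
  also have "(\<integral>x. indicator A x * ?f x - indicator A x \<partial>gibbs U) =
      (\<integral>x. indicator A x * ?f x \<partial>gibbs U) - (\<integral>x. indicator A x \<partial>gibbs U)"
    by (rule Bochner_Integration.integral_diff[OF fA iA])
  also have "(\<integral>x. 1 / 2 * ?f x - 1 / 2 \<partial>gibbs U) = (\<integral>x. 1 / 2 * ?f x \<partial>gibbs U) - (\<integral>x. 1 / 2 \<partial>gibbs U)"
    by (rule Bochner_Integration.integral_diff) (intro integrable_mult_right relative_density(1) integrable_const)+
  also have "\<dots> = 0"
    unfolding integral_mult_right_zero relative_density(2) using prob_space by simp
  finally have diff: "measure (density lborel (\<lambda>x. ennreal (r x))) A - measure (gibbs U) A = (\<integral>x. ?h x \<partial>gibbs U)"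
    unfolding 1 2 by simp
  have ih: "integrable (gibbs U) ?h"
    unfolding h by (intro Bochner_Integration.integrable_diff[OF i1 i2])
  have "\<bar>\<integral>x. ?h x \<partial>gibbs U\<bar> \<le> (\<integral>x. \<bar>?h x\<bar> \<partial>gibbs U)" by (rule integral_abs_bound)
  also have "\<dots> \<le> (\<integral>x. ((?f x - 1)\<^sup>2 / k + k) / 4 \<partial>gibbs U)"
  proof (rule integral_mono)
    show "integrable (gibbs U) (\<lambda>x. \<bar>?h x\<bar>)" using ih by (rule integrable_abs)
    show "integrable (gibbs U) (\<lambda>x. ((?f x - 1)\<^sup>2 / k + k) / 4)"
      by (intro integrable_divide Bochner_Integration.integrable_add chi_square_eq_variance(1) integrable_const)
    fix x
    have "\<bar>?h x\<bar> = \<bar>?f x - 1\<bar> / 2" by (simp add: abs_mult indicator_def)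
    also have "\<dots> \<le> ((?f x - 1)\<^sup>2 / k + k) / 4" by (rule half_abs_le[OF k])
    finally show "\<bar>?h x\<bar> \<le> ((?f x - 1)\<^sup>2 / k + k) / 4" .
  qed
  also have "\<dots> = ((\<integral>x. (?f x - 1)\<^sup>2 \<partial>gibbs U) / k + k) / 4"
  proof -
    have "(\<integral>x. (?f x - 1)\<^sup>2 / k + k \<partial>gibbs U) = (\<integral>x. (?f x - 1)\<^sup>2 / k \<partial>gibbs U) + (\<integral>x. k \<partial>gibbs U)"
      by (rule Bochner_Integration.integral_add) (intro integrable_divide chi_square_eq_variance(1) integrable_const)+
    then show ?thesis using prob_space by simp
  qed
  finally show ?thesis unfolding diff chi_square_eq_variance .
qed

text \<open>Finiteness selects the absolutely continuous branch of the definition. There, uniqueness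
  of the Radon-Nikodym derivative identifies it with the quotient of densities, which links the
  divergence to the functional differentiated in \<open>fp_regular\<close>.\<close>

lemma chi_square_div_density_gibbs:
  assumes "chi_square_div (density lborel (\<lambda>x. ennreal (r x))) (gibbs U) < \<infinity>"
  shows "chi_square_div (density lborel (\<lambda>x. ennreal (r x))) (gibbs U) =
    ennreal ((\<integral>x. (r x)\<^sup>2 / exp (- U x) \<partial>lborel) - 1)"
proof -
  interpret prob_space "gibbs U" by (rule prob_U)
  let ?\<mu> = "density lborel (\<lambda>x. ennreal (r x))"
  let ?f = "\<lambda>x. r x / exp (- U x)"
  have "density (gibbs U) (\<lambda>x. ennreal (?f x)) = ?\<mu>"
    unfolding gibbs_def using r_nonneg
    by (subst density_density_eq) (auto simp: ennreal_mult[symmetric] intro!: density_cong)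
  then have ae: "AE x in gibbs U. ennreal (?f x) = RN_deriv (gibbs U) ?\<mu> x"
    by (intro RN_deriv_unique) auto
  have "absolutely_continuous (gibbs U) ?\<mu>"
    using assms by (auto simp: chi_square_div_def split: if_splits)
  then have "chi_square_div ?\<mu> (gibbs U) = (\<integral>\<^sup>+x. (RN_deriv (gibbs U) ?\<mu> x)\<^sup>2 \<partial>gibbs U) - 1"
    by (simp add: chi_square_div_def)
  also have "(\<integral>\<^sup>+x. (RN_deriv (gibbs U) ?\<mu> x)\<^sup>2 \<partial>gibbs U) = (\<integral>\<^sup>+x. ennreal ((?f x)\<^sup>2) \<partial>gibbs U)"
  proof (rule nn_integral_cong_AE)
    show "AE x in gibbs U. (RN_deriv (gibbs U) ?\<mu> x)\<^sup>2 = ennreal ((?f x)\<^sup>2)"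
      using ae
    proof eventually_elim
      case (elim x)
      show ?case unfolding elim[symmetric] using r_nonneg by (intro ennreal_power) auto
    qed
  qed
  also have "\<dots> = ennreal (\<integral>x. (?f x)\<^sup>2 \<partial>gibbs U)"
    by (rule nn_integral_eq_integral[OF relative_density(3)]) auto
  finally show ?thesis
    unfolding relative_density(4) using second_moment_relative_density_ge_1 by (simp add: ennreal_minus flip: ennreal_1)
qed

end

section \<open>Exponential decay along the flow\<close>

lemma chi_square_decay:
  fixes U :: "real^'n \<Rightarrow> real" and \<rho> :: "real \<Rightarrow> real^'n \<Rightarrow> real"
  assumes U: "twice_continuously_differentiable U" and prob: "prob_space (gibbs U)"
    and \<kappa>: "0 < \<kappa>" "\<And>z w. \<kappa> * (norm w)\<^sup>2 \<le> U (z + w) + U (z - w) - 2 * U z"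
    and \<rho>: "\<And>t. 0 \<le> t \<Longrightarrow> \<rho> t \<in> borel_measurable borel" "\<And>t x. 0 \<le> t \<Longrightarrow> 0 \<le> \<rho> t x"
      "\<And>t. 0 \<le> t \<Longrightarrow> prob_space (density lborel (\<lambda>x. ennreal (\<rho> t x)))"
    and fp: "fokker_planck U \<rho>" and reg: "fp_regular U \<rho>" and t: "0 \<le> t"
  shows "(\<integral>x. (\<rho> t x)\<^sup>2 / exp (- U x) \<partial>lborel) - 1
    \<le> exp (- 2 * t) * ((\<integral>x. (\<rho> 0 x)\<^sup>2 / exp (- U x) \<partial>lborel) - 1)"
proof -
  define J where "J s = (\<integral>x. (\<rho> s x)\<^sup>2 / exp (- U x) \<partial>lborel)" for s
  have U_cont: "continuous_on UNIV U" by (rule gderiv_imp_continuous_on[OF tcd_gderiv[OF U]])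
  have U_meas: "U \<in> borel_measurable borel" by (rule borel_measurable_continuous_onI[OF U_cont])
  have J_int: "integrable lborel (\<lambda>x. (\<rho> s x)\<^sup>2 / exp (- U x))" if "0 \<le> s" for s
    using reg that by (simp add: fp_regular_def)
  have J_cont: "continuous_on {0..} J" using reg by (simp add: fp_regular_def J_def[abs_def])
  note lower = hessian_lower_bound[OF U \<kappa>(2)]
  have decay: "\<exists>D. (J has_real_derivative D) (at s) \<and> D \<le> - 2 * (J s - 1)" if s: "0 < s" for s
  proof -
    define f where "f x = \<rho> s x / exp (- U x)" for x
    define a where "a x = grad f x" for x
    define b where "b x = matrix_inv (hessian U x) *v a x" for x
    have fpos: "0 < f x" for x using fp s by (simp add: fokker_planck_def f_def)
    have \<rho>_diff: "\<rho> s differentiable (at x)" and flux_diff: "fp_flux U (\<rho> s) differentiable (at x)"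
      and \<rho>_dt: "((\<lambda>r. \<rho> r x) has_real_derivative divergence (fp_flux U (\<rho> s)) x) (at s)" for x
      using fp s by (auto simp: fokker_planck_def)
    have f: "GDERIV f x :> a x" for x
    proof -
      have "(U has_derivative (\<lambda>h. h \<bullet> grad U x)) (at x)" using tcd_gderiv[OF U, of x] by (simp add: gderiv_def)
      then have "(\<lambda>x. exp (U x)) differentiable (at x)"
        by (auto intro!: differentiableI derivative_eq_intros)
      then have "(\<lambda>x. \<rho> s x * exp (U x)) differentiable (at x)"
        using \<rho>_diff by (intro differentiable_mult)
      moreover have "f = (\<lambda>x. \<rho> s x * exp (U x))"
        by (simp add: fun_eq_iff f_def exp_minus divide_inverse)
      ultimately show ?thesis unfolding a_def by (simp add: gderiv_grad)
    qed
    have Hb: "hessian U x *v b x = a x" for x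
      unfolding b_def by (rule positive_definite_matrix_inv[OF \<kappa>(1) lower])
    \<comment> \<open>The factor 1 / f from the logarithm cancels against the density, so pairing
      the flux with the gradient of f gives exactly the Brascamp-Lieb form.\<close>
    have flux: "fp_flux U (\<rho> s) x = exp (- U x) *\<^sub>R b x" for x
    proof -
      have "GDERIV (\<lambda>y. ln (f y)) x :> inverse (f x) *\<^sub>R a x"
        by (rule GDERIV_DERIV_compose[OF f DERIV_ln[OF fpos]])
      then have "grad (\<lambda>y. ln (\<rho> s y / exp (- U y))) x = inverse (f x) *\<^sub>R a x"
        unfolding f_def[symmetric] by (rule grad_eqI)
      moreover have "\<rho> s x * inverse (f x) = exp (- U x)"
        using fpos[of x] by (simp add: f_def field_simps)
      ultimately show ?thesis
        unfolding fp_flux_def b_def by (simp add: matrix_vector_mult_scaleR)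
    qed
    \<comment> \<open>\<open>fokker_planck\<close> makes the flux differentiable, but not the
      gradient of the density. Continuity of \<open>a\<close> is recovered by multiplying the flux
      by exp U and the Hessian.\<close>
    have a_cont: "continuous_on UNIV a"
    proof -
      have "continuous_on UNIV (fp_flux U (\<rho> s))"
        using flux_diff differentiable_imp_continuous_on
        by (metis differentiable_at_imp_differentiable_on)
      then have "continuous_on UNIV (\<lambda>x. hessian U x *v (exp (U x) *\<^sub>R fp_flux U (\<rho> s) x))"
        by (intro continuous_on_matrix_vector_mult tcd_hessian_continuous[OF U] continuous_intros U_cont)
      moreover have "hessian U x *v (exp (U x) *\<^sub>R fp_flux U (\<rho> s) x) = a x" for x
        unfolding flux using Hb[of x] by (simp add: exp_minus)
      ultimately show ?thesis by simp
    qed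
    have b_cont: "continuous_on UNIV b"
      by (rule hessian_solution_continuous[OF U \<kappa>(1) lower a_cont Hb])
    have ab_meas: "(\<lambda>x. a x \<bullet> b x) \<in> borel_measurable borel"
      by (intro borel_measurable_continuous_onI continuous_on_inner a_cont b_cont)
    note parts = reg[unfolded fp_regular_def, THEN conjunct2, THEN conjunct2, THEN conjunct2, rule_format, OF s]
    have gr: "grad (\<lambda>y. 2 * (\<rho> s y / exp (- U y))) x \<bullet> fp_flux U (\<rho> s) x = 2 * (exp (- U x) * (a x \<bullet> b x))" for x
    proof -
      have "GDERIV (\<lambda>y. 2 * f y) x :> 2 *\<^sub>R a x + f x *\<^sub>R 0"
        by (intro gderiv_mult GDERIV_const f)
      then have "grad (\<lambda>y. 2 * (\<rho> s y / exp (- U y))) x = 2 *\<^sub>R a x"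
        unfolding f_def[symmetric] by (intro grad_eqI) simp
      then show ?thesis unfolding flux by simp
    qed
    have int_ab: "integrable (gibbs U) (\<lambda>x. a x \<bullet> b x)"
    proof -
      have "integrable lborel (\<lambda>x. 2 * (exp (- U x) * (a x \<bullet> b x)))"
        using parts unfolding gr by (rule conjunct1)
      then show ?thesis using ab_meas U_meas by (subst integrable_gibbs_iff) auto
    qed
    define D where "D = (\<integral>x. deriv (\<lambda>r. (\<rho> r x)\<^sup>2 / exp (- U x)) s \<partial>lborel)"
    have JD: "(J has_real_derivative D) (at s)"
      using reg s unfolding fp_regular_def J_def[abs_def] D_def by blast
    have "deriv (\<lambda>r. (\<rho> r x)\<^sup>2 / exp (- U x)) s = 2 * (\<rho> s x / exp (- U x)) * divergence (fp_flux U (\<rho> s)) x" for x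
      by (rule DERIV_imp_deriv) (auto intro!: derivative_eq_intros \<rho>_dt)
    then have "D = (\<integral>x. 2 * (\<rho> s x / exp (- U x)) * divergence (fp_flux U (\<rho> s)) x \<partial>lborel)"
      unfolding D_def by (simp only:)
    also have "\<dots> = - (\<integral>x. 2 * (exp (- U x) * (a x \<bullet> b x)) \<partial>lborel)"
      using parts unfolding gr by (rule conjunct2)
    also have "\<dots> = - 2 * (\<integral>x. a x \<bullet> b x \<partial>gibbs U)"
      unfolding integral_gibbs[OF U_meas ab_meas] by simp
    finally have D: "D = - 2 * (\<integral>x. a x \<bullet> b x \<partial>gibbs U)" .
    have s0: "0 \<le> s" using s by simp
    note rel = relative_density[OF U_meas prob \<rho>(1,2)[OF s0] \<rho>(3)[OF s0] J_int[OF s0], folded f_def]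
    have "(\<integral>x. (f x)\<^sup>2 \<partial>gibbs U) - (\<integral>x. f x \<partial>gibbs U)\<^sup>2 \<le> (\<integral>x. a x \<bullet> b x \<partial>gibbs U)"
      by (rule brascamp_lieb[OF U prob \<kappa> f a_cont Hb rel(3) int_ab])
    then have "J s - 1 \<le> (\<integral>x. a x \<bullet> b x \<partial>gibbs U)"
      unfolding rel(2,4) J_def by simp
    then show ?thesis using JD D by (intro exI[of _ D]) simp
  qed
  \<comment> \<open>An integrating factor in place of Gronwall. Derivatives exist at positive times
    only; the continuity of \<open>J\<close> at 0 in \<open>fp_regular\<close> closes the
    interval.\<close>
  let ?K = "\<lambda>s. exp (2 * s) * (J s - 1)"
  have "?K t \<le> ?K 0"
  proof (rule DERIV_nonpos_imp_decreasing_open[OF t])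
    fix s assume "0 < s" "s < t"
    then obtain D where D: "(J has_real_derivative D) (at s)" "D \<le> - 2 * (J s - 1)" using decay by blast
    have "(?K has_real_derivative (2 * exp (2 * s) * (J s - 1) + exp (2 * s) * D)) (at s)"
      using D(1) by (auto intro!: derivative_eq_intros)
    moreover have "2 * exp (2 * s) * (J s - 1) + exp (2 * s) * D = exp (2 * s) * (2 * (J s - 1) + D)"
      by (simp add: algebra_simps)
    moreover have "exp (2 * s) * (2 * (J s - 1) + D) \<le> 0"
      using D(2) by (intro mult_nonneg_nonpos) auto
    ultimately show "\<exists>y. (?K has_real_derivative y) (at s) \<and> y \<le> 0" by metis
  next
    show "continuous_on {0..t} ?K"
      by (intro continuous_intros continuous_on_subset[OF J_cont]) auto
  qed
  then have "exp (2 * t) * (J t - 1) \<le> J 0 - 1" by simp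
  then have "exp (- 2 * t) * (exp (2 * t) * (J t - 1)) \<le> exp (- 2 * t) * (J 0 - 1)"
    by (intro mult_left_mono) auto
  then show ?thesis by (simp add: J_def exp_add[symmetric] mult.assoc[symmetric])
qed

section \<open>The mixing time bound\<close>

theorem corollary2:
  fixes V :: "real^'n \<Rightarrow> real" and \<epsilon> \<beta> :: real
    and M :: "'w measure" and F :: "real \<Rightarrow> 'w measure"
    and B X Y :: "real \<Rightarrow> 'w \<Rightarrow> real^'n"
    and \<rho> :: "real \<Rightarrow> real^'n \<Rightarrow> real"
  assumes "0 < \<epsilon>"
    and "convex_on UNIV V"
    and "twice_continuously_differentiable V"
    and "prob_space (gibbs V)"
    and "0 < \<beta>"
    and "\<beta> \<le> \<epsilon>\<^sup>2 / (2 * (\<integral>x. (norm x)\<^sup>2 \<partial>gibbs V))"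
    and "newton_langevin (tilted V \<beta>) M F B X Y"
    and "\<forall>t\<ge>0. distributed M lborel (X t) (\<lambda>x. ennreal (\<rho> t x)) \<and> (\<forall>x. 0 \<le> \<rho> t x)"
    and "fokker_planck (tilted V \<beta>) \<rho>"
    and "chi_square_div (distr M borel (X 0)) (gibbs (tilted V \<beta>)) < \<infinity> \<Longrightarrow>
      fp_regular (tilted V \<beta>) \<rho>"
  shows "\<forall>t\<ge>0.
    ereal (1/2) * ln_ennreal (2 * chi_square_div (distr M borel (X 0)) (gibbs (tilted V \<beta>)))
      + ereal (ln (1 / \<epsilon>)) \<le> ereal t \<longrightarrow>
    tv_dist (distr M borel (X t)) (gibbs V) \<le> \<epsilon>"
proof (intro allI impI)
  fix t :: real
  assume t: "0 \<le> t" and time: "ereal (1/2) *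
      ln_ennreal (2 * chi_square_div (distr M borel (X 0)) (gibbs (tilted V \<beta>))) + ereal (ln (1 / \<epsilon>)) \<le> ereal t"
  interpret M: prob_space M using assms(7) by (simp add: newton_langevin_def)
  interpret V: prob_space "gibbs V" by fact
  let ?U = "tilted V \<beta>"
  let ?J = "\<lambda>t. \<integral>x. (\<rho> t x)\<^sup>2 / exp (- ?U x) \<partial>lborel"
  define m where "m = (\<integral>x. (norm x)\<^sup>2 \<partial>gibbs V)"
  have V_meas: "V \<in> borel_measurable borel"
    by (intro borel_measurable_continuous_onI gderiv_imp_continuous_on[OF tcd_gderiv[OF assms(3)]])
  have U_meas: "?U \<in> borel_measurable borel" by (rule tilted_measurable[OF V_meas assms(4,5)])
  have U: "twice_continuously_differentiable ?U"
    by (rule twice_continuously_differentiable_tilted[OF assms(3)])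
  have prob_U: "prob_space (gibbs ?U)" by (rule prob_space_gibbs_tilted[OF V_meas assms(4,5)])
  interpret U: prob_space "gibbs ?U" by (rule prob_U)
  have dist: "distributed M lborel (X s) (\<lambda>x. ennreal (\<rho> s x))" and \<rho>_nonneg: "0 \<le> \<rho> s x" if "0 \<le> s" for s x
    using assms(8) that by auto
  have law: "distr M borel (X s) = density lborel (\<lambda>x. ennreal (\<rho> s x))" if "0 \<le> s" for s
  proof -
    have "distr M borel (X s) = distr M lborel (X s)" by (rule distr_cong) simp_all
    then show ?thesis using distributed_distr_eq_density[OF dist[OF that]] by simp
  qed
  have \<rho>_meas: "\<rho> s \<in> borel_measurable borel" if "0 \<le> s" for s
    using distributed_real_measurable[OF _ dist[OF that]] \<rho>_nonneg[OF that] by simp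
  have prob_\<rho>: "prob_space (density lborel (\<lambda>x. ennreal (\<rho> s x)))" if "0 \<le> s" for s
    using M.prob_space_distr[of "X s" lborel] dist[OF that]
    by (metis distributed_distr_eq_density distributed_measurable)
  show "tv_dist (distr M borel (X t)) (gibbs V) \<le> \<epsilon>"
    unfolding tv_dist_def
  proof (rule cSUP_least)
    show "sets (distr M borel (X t)) \<noteq> {}" by (metis sets.empty_sets empty_iff)
    fix A assume "A \<in> sets (distr M borel (X t))"
    then have A: "A \<in> sets borel" by simp
    interpret X: prob_space "density lborel (\<lambda>x. ennreal (\<rho> t x))" by (rule prob_\<rho>[OF t])
    show "\<bar>measure (distr M borel (X t)) A - measure (gibbs V) A\<bar> \<le> \<epsilon>"
    \<comment> \<open>Probabilities differ by at most 1, so larger \<epsilon> are trivial; for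
      \<epsilon> \<le> 1 the bias \<epsilon>^2 / 2 is at most \<epsilon> / 2.\<close>
    proof (cases "\<epsilon> \<le> 1")
      case False
      have "0 \<le> measure (distr M borel (X t)) A" "measure (distr M borel (X t)) A \<le> 1"
        "0 \<le> measure (gibbs V) A" "measure (gibbs V) A \<le> 1"
        unfolding law[OF t] by (auto intro: X.prob_le_1 V.prob_le_1)
      then show ?thesis using False by linarith
    next
      case True
      \<comment> \<open>If the second moment were infinite, \<open>m\<close> would be the junk value 0 and so would the bound on \<open>\<beta>\<close>.\<close>
      have m_pos: "0 < m"
      proof (rule ccontr)
        assume "\<not> 0 < m"
        then have "\<epsilon>\<^sup>2 / (2 * m) \<le> 0" by (simp add: divide_nonneg_nonpos)
        then show False using assms(5,6) unfolding m_def by linarith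
      qed
      then have int_m: "integrable (gibbs V) (\<lambda>x. (norm x)\<^sup>2)"
        unfolding m_def using not_integrable_integral_eq by fastforce
      have "\<beta> * m \<le> \<epsilon>\<^sup>2 / 2"
        using assms(6) m_pos unfolding m_def[symmetric] by (simp add: field_simps)
      also have "\<dots> \<le> \<epsilon> / 2" using True assms(1) by (simp add: power2_eq_square mult_left_le)
      finally have UV: "\<bar>measure (gibbs ?U) A - measure (gibbs V) A\<bar> \<le> \<epsilon> / 2"
        using gibbs_tilted_tv[OF V_meas assms(4,5) int_m A] unfolding m_def by linarith
      let ?\<chi> = "chi_square_div (distr M borel (X 0)) (gibbs ?U)"
      \<comment> \<open>An infinite divergence makes the threshold time infinite, which no real
        \<open>t\<close> reaches.\<close>
      have fin: "?\<chi> < \<infinity>"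
      proof (rule ccontr)
        assume "\<not> ?\<chi> < \<infinity>"
        then have "?\<chi> = \<infinity>" by (simp add: less_top[symmetric])
        then have "2 * ?\<chi> = \<infinity>" by (simp add: ennreal_mult_top)
        then show False using time by (simp add: ln_ennreal_def)
      qed
      then have reg: "fp_regular ?U \<rho>" by (rule assms(10))
      have J_int: "integrable lborel (\<lambda>x. (\<rho> s x)\<^sup>2 / exp (- ?U x))" if "0 \<le> s" for s
        using reg that by (simp add: fp_regular_def)
      have nonneg: "0 \<le> ?J 0 - 1"
      proof -
        have "1 \<le> ?J 0"
          by (rule second_moment_relative_density_ge_1[OF U_meas prob_U \<rho>_meas \<rho>_nonneg prob_\<rho> J_int]) simp_all
        then show ?thesis by simp
      qed
      have \<chi>: "?\<chi> = ennreal (?J 0 - 1)"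
        unfolding law[OF order_refl]
        by (rule chi_square_div_density_gibbs[OF U_meas prob_U \<rho>_meas \<rho>_nonneg prob_\<rho> J_int])
           (use fin law[of 0] in auto)
      have "?J t - 1 \<le> exp (- 2 * t) * (?J 0 - 1)"
        by (rule chi_square_decay[OF U prob_U _ tilted_strongly_convex[OF assms(2)] \<rho>_meas \<rho>_nonneg prob_\<rho> assms(9) reg t])
           (use assms(5) in auto)
      also have "\<dots> \<le> \<epsilon>\<^sup>2 / 2"
      \<comment> \<open>At divergence 0 the threshold is minus infinity and carries no information,
        but then the claim is immediate.\<close>
      proof (cases "?J 0 - 1 = 0")
        case False
        define c where "c = ?J 0 - 1"
        have c: "0 < c" using False nonneg by (simp add: c_def)
        have "2 * ?\<chi> = ennreal (2 * c)"
          unfolding \<chi> c_def[symmetric] using c by (simp add: ennreal_mult)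
        then have "ln_ennreal (2 * ?\<chi>) = ereal (ln (2 * c))"
          using c by (simp add: ln_ennreal_def)
        \<comment> \<open>Exponentiating twice this inequality gives 2 c \<le> \<epsilon>^2 exp (2
          t), exactly what the decay needs to reach \<epsilon>^2 / 2.\<close>
        then have "1 / 2 * ln (2 * c) + ln (1 / \<epsilon>) \<le> t" using time by simp
        then have "ln (2 * c) - 2 * ln \<epsilon> \<le> 2 * t" using assms(1) by (simp add: ln_div)
        then have "ln (2 * c / \<epsilon>\<^sup>2) \<le> 2 * t" using assms(1) c by (simp add: ln_div ln_realpow)
        then have "exp (ln (2 * c / \<epsilon>\<^sup>2)) \<le> exp (2 * t)" by (simp only: exp_le_cancel_iff)
        then have "2 * c / \<epsilon>\<^sup>2 \<le> exp (2 * t)" using assms(1) c by simp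
        then have "2 * c \<le> exp (2 * t) * \<epsilon>\<^sup>2" using assms(1) by (simp add: pos_divide_le_eq)
        then have "exp (- 2 * t) * (2 * c) \<le> exp (- 2 * t) * (exp (2 * t) * \<epsilon>\<^sup>2)"
          by (intro mult_left_mono) auto
        then show ?thesis by (simp add: c_def[symmetric] exp_add[symmetric] mult.assoc[symmetric])
      qed simp
      finally have chi_t: "?J t - 1 \<le> \<epsilon>\<^sup>2 / 2" .
      \<comment> \<open>With \<open>k\<close> equal to \<epsilon> and divergence at most
        \<epsilon>^2 / 2 the bound is 3 \<epsilon> / 8, within the half reserved for it.\<close>
      have "\<bar>measure (density lborel (\<lambda>x. ennreal (\<rho> t x))) A - measure (gibbs ?U) A\<bar> \<le> ((?J t - 1) / \<epsilon> + \<epsilon>) / 4"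
        by (rule measure_density_gibbs_diff_le[OF U_meas prob_U \<rho>_meas \<rho>_nonneg prob_\<rho> J_int]) (use t A assms(1) in auto)
      also have "\<dots> \<le> (\<epsilon>\<^sup>2 / 2 / \<epsilon> + \<epsilon>) / 4"
        using chi_t assms(1) by (intro divide_right_mono add_right_mono) auto
      also have "\<dots> \<le> \<epsilon> / 2" using assms(1) by (simp add: power2_eq_square)
      finally show ?thesis using UV unfolding law[OF t] by linarith
    qed
  qed
qed

end
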